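(* Let $\sigma=\{\sigma_i\mid i\in I\}$ be a partition of the set of all primes and let $G$ be a finite group. Suppose that $G$ has a $\sigma$-nilpotent normal Hall subgroup $D$ with $G/D$ $\sigma$-nilpotent such that $G/O^{\sigma_i}(D)$ is a special $P\sigma T$-group for each $\sigma_i\in\sigma(D)$. Then $G$ is a $P\sigma T$-group.
   Context: All groups are finite. $\sigma=\{\sigma_i\mid i\in I\}$ is a partition of the set $\mathbb{P}$ of primes. For $n\in\mathbb{N}$, $\sigma(n)=\{\sigma_i\mid \sigma_i\cap\pi(n)\ne\emptyset\}$ with $\pi(n)$ the primes dividing $n$; $\sigma(G)=\sigma(|G|)$. A group is $\sigma$-primary if $|\sigma(G)|\le1$, a $\sigma_i$-group if all prime divisors of its order lie in $\sigma_i$, and $\sigma$-nilpotent if it is a direct product of $\sigma$-primary groups. $O^{\sigma_i}(D)$ denotes the smallest normal subgroup of $D$ whose quotient is a $\sigma_i$-group. A Hall $\sigma_i$-subgroup of $G$ is a subgroup whose order is a $\sigma_i$-number and whose index has no prime divisor in $\sigma_i$. The $\sigma$-nilpotent residual $G^{\mathfrak{N}_\sigma}$ is the intersection of all normal subgroups $N$ of $G$ with $G/N$ $\sigma$-nilpotent. A power automorphism of a group $D$ is an automorphism mapping every subgroup of $D$ onto itself; an element of $G$ induces a power automorphism in a normal subgroup $D$ if conjugation by it is a power automorphism of $D$. $G$ is a special $P\sigma T$-group if $D_0=G^{\mathfrak{N}_\sigma}$ is contained in a Hall $\sigma_i$-subgroup $E$ of $G$ for some $i$ and: (i) $D_0$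 is a Hall subgroup of $G$ and every element of $G$ induces a power automorphism in $D_0$; (ii) $D_0$ has a normal complement $S$ in $E$. A complete Hall $\sigma$-set of $G$ is a set $\mathcal{H}$ of subgroups such that every nontrivial member is a Hall $\sigma_i$-subgroup for some $i$ and $\mathcal{H}$ contains exactly one Hall $\sigma_i$-subgroup of $G$ for each $\sigma_i\in\sigma(G)$. A subgroup $A$ is $\sigma$-quasinormal in $G$ if $G$ has a complete Hall $\sigma$-set $\mathcal{H}$ with $AH^x=H^xA$ for all $H\in\mathcal{H}$, $x\in G$. $G$ is a $P\sigma T$-group if whenever $K$ is $\sigma$-quasinormal in $H$ and $H$ is $\sigma$-quasinormal in $G$, then $K$ is $\sigma$-quasinormal in $G$. *)

theory Defs
  imports "HOL-Algebra.Algebra" "HOL-Library.Disjoint_Sets"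
begin

text \<open>Throughout, \<Sigma> is a set of sets of primes; it is a partition of the primes
  when partition_on primes_set \<Sigma> holds.\<close>

definition primes_set :: "nat set" where
  "primes_set = {p::nat. Factorial_Ring.prime p}"

definition sigma_of_nat :: "nat set set \<Rightarrow> nat \<Rightarrow> nat set set" where
  "sigma_of_nat \<Sigma> n = {s \<in> \<Sigma>. s \<inter> prime_factors n \<noteq> {}}"

definition sigma_of_group :: "nat set set \<Rightarrow> ('a, 'b) monoid_scheme \<Rightarrow> nat set set" where
  "sigma_of_group \<Sigma> G = sigma_of_nat \<Sigma> (order G)"

definition sigma_primary :: "nat set set \<Rightarrow> ('a, 'b) monoid_scheme \<Rightarrow> bool" where
  "sigma_primary \<Sigma> G \<longleftrightarrow> card (sigma_of_group \<Sigma> G) \<le> 1"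

definition s_number :: "nat set \<Rightarrow> nat \<Rightarrow> bool" where
  "s_number s n \<longleftrightarrow> prime_factors n \<subseteq> s"

definition sigma_nilpotent :: "nat set set \<Rightarrow> ('a, 'b) monoid_scheme \<Rightarrow> bool" where
  "sigma_nilpotent \<Sigma> G \<longleftrightarrow>
     (\<exists>\<H>. finite \<H> \<and>
        (\<forall>H\<in>\<H>. H \<lhd> G \<and> sigma_primary \<Sigma> (G\<lparr>carrier := H\<rparr>)) \<and>
        (\<forall>H\<in>\<H>. H \<inter> generate G (\<Union>(\<H> - {H})) \<subseteq> {\<one>\<^bsub>G\<^esub>}) \<and>
        generate G (\<Union>\<H>) = carrier G)"

definition O_sigma :: "nat set \<Rightarrow> ('a, 'b) monoid_scheme \<Rightarrow> 'a set \<Rightarrow> 'a set" where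
  "O_sigma s G D = \<Inter>{N. N \<lhd> G\<lparr>carrier := D\<rparr> \<and> s_number s (card D div card N)}"

definition hall_subgroup :: "('a, 'b) monoid_scheme \<Rightarrow> 'a set \<Rightarrow> bool" where
  "hall_subgroup G H \<longleftrightarrow> subgroup H G \<and> coprime (card H) (order G div card H)"

definition hall_sigma_subgroup :: "nat set \<Rightarrow> ('a, 'b) monoid_scheme \<Rightarrow> 'a set \<Rightarrow> bool" where
  "hall_sigma_subgroup s G H \<longleftrightarrow> subgroup H G \<and> s_number s (card H)
      \<and> prime_factors (order G div card H) \<inter> s = {}"

definition sigma_nilpotent_residual :: "nat set set \<Rightarrow> ('a, 'b) monoid_scheme \<Rightarrow> 'a set" where
  "sigma_nilpotent_residual \<Sigma> G = \<Inter>{N. N \<lhd> G \<and> sigma_nilpotent \<Sigma> (G Mod N)}"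

definition induces_power_auts :: "('a, 'b) monoid_scheme \<Rightarrow> 'a set \<Rightarrow> bool" where
  "induces_power_auts G D \<longleftrightarrow>
     (\<forall>g\<in>carrier G. \<forall>H. subgroup H (G\<lparr>carrier := D\<rparr>) \<longrightarrow>
        (\<lambda>h. inv\<^bsub>G\<^esub> g \<otimes>\<^bsub>G\<^esub> h \<otimes>\<^bsub>G\<^esub> g) ` H = H)"

definition special_PsT :: "nat set set \<Rightarrow> ('a, 'b) monoid_scheme \<Rightarrow> bool" where
  "special_PsT \<Sigma> G \<longleftrightarrow>
     (let D0 = sigma_nilpotent_residual \<Sigma> G in
      \<exists>s\<in>\<Sigma>. \<exists>E. hall_sigma_subgroup s G E \<and> D0 \<subseteq> E \<and>
        hall_subgroup G D0 \<and> induces_power_auts G D0 \<and>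
        (\<exists>S. S \<lhd> G\<lparr>carrier := E\<rparr> \<and> D0 <#>\<^bsub>G\<^esub> S = E \<and> D0 \<inter> S = {\<one>\<^bsub>G\<^esub>}))"

definition complete_hall_sigma_set :: "nat set set \<Rightarrow> ('a, 'b) monoid_scheme \<Rightarrow> 'a set set \<Rightarrow> bool" where
  "complete_hall_sigma_set \<Sigma> G \<H> \<longleftrightarrow>
     (\<forall>H\<in>\<H>. subgroup H G) \<and>
     (\<forall>H\<in>\<H>. H \<noteq> {\<one>\<^bsub>G\<^esub>} \<longrightarrow> (\<exists>s\<in>\<Sigma>. hall_sigma_subgroup s G H)) \<and>
     (\<forall>s\<in>sigma_of_group \<Sigma> G. \<exists>!H. H \<in> \<H> \<and> hall_sigma_subgroup s G H)"

definition sigma_quasinormal :: "nat set set \<Rightarrow> ('a, 'b) monoid_scheme \<Rightarrow> 'a set \<Rightarrow> bool" where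
  "sigma_quasinormal \<Sigma> G A \<longleftrightarrow> subgroup A G \<and>
     (\<exists>\<H>. complete_hall_sigma_set \<Sigma> G \<H> \<and>
        (\<forall>H\<in>\<H>. \<forall>x\<in>carrier G.
           A <#>\<^bsub>G\<^esub> ((inv\<^bsub>G\<^esub> x <#\<^bsub>G\<^esub> H) #>\<^bsub>G\<^esub> x) =
           ((inv\<^bsub>G\<^esub> x <#\<^bsub>G\<^esub> H) #>\<^bsub>G\<^esub> x) <#>\<^bsub>G\<^esub> A))"

definition PsT_group :: "nat set set \<Rightarrow> ('a, 'b) monoid_scheme \<Rightarrow> bool" where
  "PsT_group \<Sigma> G \<longleftrightarrow>
     (\<forall>H K. sigma_quasinormal \<Sigma> G H \<longrightarrow> sigma_quasinormal \<Sigma> (G\<lparr>carrier := H\<rparr>) K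
        \<longrightarrow> sigma_quasinormal \<Sigma> G K)"

end

theory Submission
  imports Defs
begin

text \<open>
  Let R be the subgroup of those elements of D whose image in every G / O^s(D), for s in
  \<sigma>(D), lies in the \<sigma>-nilpotent residual of that quotient. Then R is a normal Hall
  subgroup of G, all subgroups of R are normal in G, G / R is \<sigma>-nilpotent, and elements
  of prime power order p^m in G and q^n in R commute if p and q are distinct primes of the same
  class. These properties pass to subgroups H (with R \<inter> H), and they suffice.

  Let H be \<sigma>-quasinormal in G and let k in H have prime power order prime to |R|, the
  prime lying in s. Every conjugate A of a Hall s-subgroup meets H in a Hall s-subgroup of H, so
  k lies in A (H \<inter> R). Comparing A with its conjugates under R shows that k centralizes R
  modulo H \<inter> R. For K \<sigma>-quasinormal in H, coprime action improves this to: k in K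
  centralizes R modulo N = K \<inter> R, which is normal in G. Hence for a Hall t-subgroup A of G,
  either t = s and k lies in A N, or t differs from s and conjugation by A fixes the coset k N;
  since K is generated by N and such elements k, it permutes with A.
\<close>

section \<open>Arithmetic of s-numbers\<close>

text \<open>Two passages shape the development. The first goes from G down to a quasinormal subgroup
  H. The assumptions on R are therefore phrased through elements, powers and roots: such statements
  restrict to H at once, while a direct decomposition of G / R would have to be rebuilt for H. The
  obstacle is that quasinormality of K in H describes the action of K only on H \<inter> R, whereas
  permuting with Hall subgroups of G needs the action on all of R. Commutators [r, k] bridge the
  gap: the quasinormality of H already puts them into H \<inter> R. The second passage goes from the
  quotients G / O^s(D) up to G. Since D is \<sigma>-nilpotent, its s-elements and its s'-elements
  form two subgroups meeting trivially, and O^s(D) is the second one. Hence G / O^s(D) sees the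
  s-part of D faithfully, and properties of R can be checked one prime, and so one class, at a time.
  This is why so many arguments split an element into powers of itself of prime power order.\<close>

abbreviation nat_prime :: "nat \<Rightarrow> bool" where
  "nat_prime \<equiv> Factorial_Ring.prime"

text \<open>As \<open>prime_factors 0\<close> is empty, \<open>s_number s 0\<close> is true; this is
  the source of the positivity assumptions here and below.\<close>

lemma s_number_dvd: "s_number s n \<Longrightarrow> m dvd n \<Longrightarrow> n > 0 \<Longrightarrow> s_number s m"
  unfolding s_number_def using dvd_prime_factors[of n m] by auto

lemma s_number_mult: "s_number s m \<Longrightarrow> s_number s n \<Longrightarrow> s_number s (m * n)"
  unfolding s_number_def by (cases "m = 0 \<or> n = 0") (auto simp: prime_factors_product)

lemma s_number_prime_power: "nat_prime p \<Longrightarrow> p \<in> s \<Longrightarrow> s_number s (p ^ n)"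
  unfolding s_number_def by (metis in_prime_factors_iff prime_dvd_power primes_dvd_imp_eq subsetI)

lemma s_number_prime_dvd: "s_number s n \<Longrightarrow> n > 0 \<Longrightarrow> nat_prime p \<Longrightarrow> p dvd n \<Longrightarrow> p \<in> s"
  unfolding s_number_def by (auto simp: in_prime_factors_iff)

lemma s_numberI: "(\<And>p. nat_prime p \<Longrightarrow> p dvd n \<Longrightarrow> p \<in> s) \<Longrightarrow> s_number s n"
  unfolding s_number_def by (auto simp: in_prime_factors_iff)

lemma coprime_natI:
  fixes a b :: nat
  assumes "\<And>p. nat_prime p \<Longrightarrow> p dvd a \<Longrightarrow> p dvd b \<Longrightarrow> False"
  shows "coprime a b"
proof (rule ccontr)
  assume "\<not> coprime a b"
  then have "gcd a b \<noteq> 1" by (simp add: coprime_iff_gcd_eq_1)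
  then obtain p where "nat_prime p" "p dvd gcd a b" using prime_factor_nat by blast
  then show False using assms by auto
qed

lemma s_number_coprime:
  assumes "s_number s a" "s_number (- s) b" "a > 0" "b > 0"
  shows "coprime a b"
  using s_number_prime_dvd[OF assms(1,3)] s_number_prime_dvd[OF assms(2,4)]
  by (intro coprime_natI) auto

lemma coprime_prime_power:
  assumes "nat_prime p" "\<not> p dvd n"
  shows "coprime (p ^ k) (n :: nat)"
  using assms by (simp add: prime_imp_coprime)

text \<open>Applied to a group order, the s-part e and the s'-part f become the exponents that
  separate s-elements from s'-elements.\<close>

lemma s_number_split:
  assumes "(n :: nat) > 0"
  obtains e f where "n = e * f" "s_number s e" "s_number (- s) f" "e > 0" "f > 0"
  using assms
proof (induction n arbitrary: thesis rule: less_induct)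
  case (less n)
  show ?case
  proof (cases "n = 1")
    case True
    show ?thesis by (rule less.prems(1)[of 1 1]) (use True in \<open>auto simp: s_number_def\<close>)
  next
    case False
    then obtain p where p: "nat_prime p" "p dvd n" using prime_factor_nat by blast
    then obtain m where m: "n = p * m" by (elim dvdE)
    have "m < n" "m > 0" using m p less.prems(2) prime_gt_1_nat by auto
    then obtain e f where ef: "m = e * f" "s_number s e" "s_number (- s) f" "e > 0" "f > 0"
      using less.IH by blast
    show ?thesis
    proof (cases "p \<in> s")
      case True
      show ?thesis
        by (rule less.prems(1)[of "p * e" f])
          (use ef m p True s_number_prime_power[of p s 1] in \<open>auto intro: s_number_mult simp: prime_gt_0_nat\<close>)
    next
      case False
      show ?thesis
        by (rule less.prems(1)[of e "p * f"])
          (use ef m p False s_number_prime_power[of p "- s" 1] in \<open>auto intro: s_number_mult simp: prime_gt_0_nat\<close>)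
    qed
  qed
qed

section \<open>Powers, orders and indices in finite groups\<close>

context group
begin

lemma subgroup_nat_pow_closed: "subgroup H G \<Longrightarrow> h \<in> H \<Longrightarrow> h [^] (n::nat) \<in> H"
  by (induction n) (auto intro: subgroup.one_closed subgroup.m_closed)

lemma pow_gcd_mem:
  assumes N: "subgroup N G" and x: "x \<in> carrier G" and a: "x [^] (a::nat) \<in> N" and b: "x [^] (b::nat) \<in> N"
  shows "x [^] gcd a b \<in> N"
proof (cases "a = 0")
  case True
  then show ?thesis using b by simp
next
  case False
  then obtain i j where ij: "a * i = b * j + gcd a b" using bezout_nat by blast
  have ai: "x [^] (a * i) \<in> N" and bj: "x [^] (b * j) \<in> N"
    using subgroup_nat_pow_closed[OF N a] subgroup_nat_pow_closed[OF N b] x by (auto simp: nat_pow_pow)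
  have "x [^] (a * i) = x [^] (b * j) \<otimes> x [^] gcd a b"
    by (simp add: ij nat_pow_mult x)
  then have "x [^] gcd a b = inv (x [^] (b * j)) \<otimes> x [^] (a * i)"
    using x by (metis inv_solve_left nat_pow_closed)
  then show ?thesis using ai bj N by (auto intro: subgroup.m_closed subgroup.m_inv_closed)
qed

lemma pow_coprime_mem:
  assumes "subgroup N G" "x \<in> carrier G" "x [^] (a::nat) \<in> N" "x [^] (b::nat) \<in> N" "coprime a b"
  shows "x \<in> N"
  using pow_gcd_mem[OF assms(1-4)] assms by simp

lemma pow_coprime_one:
  assumes "x \<in> carrier G" "x [^] (a::nat) = \<one>" "x [^] (b::nat) = \<one>" "coprime a b"
  shows "x = \<one>"
  using pow_coprime_mem[OF triv_subgroup, of x a b] assms by simp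

lemma pow_coprime_split:
  assumes x: "x \<in> carrier G" and 1: "x [^] (a * b :: nat) = \<one>" and "coprime a b" "a > 0" "b > 0"
  obtains i j where "x = x [^] (a * i) \<otimes> x [^] (b * j)"
proof -
  obtain i j where ij: "a * i = b * j + 1"
    using bezout_nat[of a b] assms by (auto simp: coprime_iff_gcd_eq_1)
  have "x [^] (a * i) = x \<otimes> x [^] (b * j)"
    unfolding ij using nat_pow_mult[OF x, of 1 "b * j"] x by (simp add: add.commute)
  \<comment> \<open>Bezout gives x^(a i) = x x^(b j). The inverse of x^(b j) is a natural power of
    it because x^(a b) = 1.\<close>
  moreover have "x [^] (b * j) \<otimes> x [^] (b * (j * (a * b - 1))) = \<one>"
  proof -
    have "b * j + b * (j * (a * b - 1)) = a * b * (b * j)"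
      using assms(4,5) by (cases "a * b") (auto simp: algebra_simps)
    then show ?thesis using x 1 by (metis nat_pow_mult nat_pow_pow nat_pow_one)
  qed
  ultimately have "x = x [^] (a * i) \<otimes> x [^] (b * (j * (a * b - 1)))"
    using x by (simp add: m_assoc)
  then show ?thesis using that by blast
qed

text \<open>An element of a finite group is a product of powers of itself that have prime power
  order. Only closure under products is asked of \<open>U\<close>, so \<open>U\<close> may be a
  solution set that is not known to be a subgroup.\<close>

lemma primary_induct:
  assumes fin: "finite (carrier G)" and x: "x \<in> carrier G"
    and mult: "\<And>y z. y \<in> U \<Longrightarrow> z \<in> U \<Longrightarrow> y \<otimes> z \<in> U"
    and primary: "\<And>i p n. nat_prime p \<Longrightarrow> (x [^] (i::nat)) [^] (p ^ n :: nat) = \<one> \<Longrightarrow> x [^] i \<in> U"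
  shows "x \<in> U"
proof -
  have "x [^] i \<in> U" if "(x [^] i) [^] m = \<one>" "m > 0" for i m :: nat
    using that
  proof (induction m arbitrary: i rule: less_induct)
    case (less m)
    define y where "y = x [^] i"
    have y: "y \<in> carrier G" "y [^] m = \<one>" using less.prems x by (auto simp: y_def)
    show ?case
    proof (cases "m = 1")
      case True
      then show ?thesis using primary[of 2 i 0] less.prems by simp
    next
      case False
      then obtain p where p: "nat_prime p" "p dvd m" using prime_factor_nat by blast
      define a where "a = p ^ multiplicity p m"
      obtain b where b: "m = a * b" unfolding a_def using multiplicity_dvd by blast
      have nb: "\<not> p dvd b"
      proof
        assume "p dvd b"
        then have "a * p dvd m" using b by (metis mult_dvd_mono dvd_refl)
        then have "p ^ Suc (multiplicity p m) dvd m" by (simp add: a_def mult.commute)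
        then show False using p less.prems(2)
          by (metis power_dvd_iff_le_multiplicity not_less_eq_eq order_refl not_prime_unit less_numeral_extra(3))
      qed
      have cop: "coprime a b" unfolding a_def using coprime_prime_power[OF p(1) nb] .
      have pos: "a > 0" "b > 0" using less.prems(2) b by auto
      have "multiplicity p m > 0" using p less.prems(2)
        by (simp add: prime_multiplicity_gt_zero_iff)
      then have a1: "a > 1" unfolding a_def using prime_gt_1_nat[OF p(1)]
        by (metis one_less_power)
      show ?thesis
      proof (cases "b = 1")
        case True
        then show ?thesis 
          by (intro primary[OF p(1), of i "multiplicity p m"]) (metis less.prems(1) b a_def mult.right_neutral)
      next
        case False
        \<comment> \<open>The factor y^(a u) is killed by b and y^(b v) by a; both a and b are
          smaller than m, so the induction hypothesis covers them.\<close>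
        obtain u v where uv: "y = y [^] (a * u) \<otimes> y [^] (b * v)"
          using pow_coprime_split[OF y(1) _ cop pos] y b by blast
        have "(y [^] (a * u)) [^] b = \<one>"
        proof -
          have "a * u * b = m * u" using b by simp
          then show ?thesis using y by (metis nat_pow_pow nat_pow_one)
        qed
        moreover have "(y [^] (b * v)) [^] a = \<one>"
        proof -
          have "b * v * a = m * v" using b by simp
          then show ?thesis using y by (metis nat_pow_pow nat_pow_one)
        qed
        moreover have "a < m" "b < m" using b False pos a1 by auto
        moreover have "y [^] (a * u) = x [^] (i * (a * u))" "y [^] (b * v) = x [^] (i * (b * v))"
          using x by (auto simp: y_def nat_pow_pow)
        ultimately have "y [^] (a * u) \<in> U" "y [^] (b * v) \<in> U"
          using less.IH pos by auto
        then show ?thesis using uv mult unfolding y_def by metis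
      qed
    qed
  qed
  from this[of 1 "order G"] show ?thesis
    using x fin pow_order_eq_1 order_gt_0_iff_finite by simp
qed

lemma pow_card_one:
  assumes "finite (carrier G)" "subgroup H G" "h \<in> H"
  shows "h [^] card H = \<one>"
proof -
  interpret H: group "G\<lparr>carrier := H\<rparr>" using assms by (simp add: subgroup_imp_group)
  show ?thesis using H.pow_order_eq_1[of h] assms
    by (simp add: order_def nat_pow_consistent[symmetric])
qed

lemma card_subgroup_pos: "finite (carrier G) \<Longrightarrow> subgroup H G \<Longrightarrow> card H > 0"
  by (metis card_gt_0_iff finite_subset subgroup.one_closed subgroup.subset empty_iff)

lemma card_subgroup_dvd: "finite (carrier G) \<Longrightarrow> subgroup H G \<Longrightarrow> card H dvd order G"
  using lagrange by (metis dvd_triv_right)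

lemma card_subgroup_mono_dvd:
  assumes "finite (carrier G)" "subgroup H G" "subgroup K G" "H \<subseteq> K"
  shows "card H dvd card K"
proof -
  interpret K: group "G\<lparr>carrier := K\<rparr>" using assms by (simp add: subgroup_imp_group)
  show ?thesis using K.card_subgroup_dvd[of H] assms subgroup_incl[of H K]
    by (simp add: order_def) (meson finite_subset subgroup.subset)
qed

lemma prime_dvd_card_subgroup:
  assumes "finite (carrier G)" "subgroup H G" "h \<in> H" "h \<noteq> \<one>" "nat_prime p" "h [^] (p ^ n :: nat) = \<one>"
  shows "p dvd card H"
proof (rule ccontr)
  assume "\<not> p dvd card H"
  then show False
    using pow_coprime_one[of h "p ^ n" "card H"] coprime_prime_power[OF assms(5)]
      pow_card_one[OF assms(1-3)] assms subgroup.mem_carrier by metis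
qed

text \<open>Cauchy's theorem is \<open>sylow_thm\<close> with exponent 1, where the cofactor may
  still be divisible by p.\<close>

lemma cauchy:
  assumes fin: "finite (carrier G)" and H: "subgroup H G" and p: "nat_prime p" "p dvd card H"
  obtains y where "y \<in> H" "y \<noteq> \<one>" "y [^] p = \<one>"
proof -
  interpret H: group "G\<lparr>carrier := H\<rparr>" using H by (simp add: subgroup_imp_group)
  have finH: "finite H" using fin H finite_subset subgroup.subset by blast
  obtain m where "card H = p * m" using p by (elim dvdE)
  then obtain P where P: "subgroup P (G\<lparr>carrier := H\<rparr>)" "card P = p"
    using sylow_thm[of p "G\<lparr>carrier := H\<rparr>" 1 m] p H.is_group finH by (auto simp: order_def)
  have PG: "subgroup P G" "P \<subseteq> H" using P H incl_subgroup subgroup.subset[OF P(1)] by auto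
  have "P \<noteq> {\<one>}" using P(2) p prime_gt_1_nat by fastforce
  then obtain y where "y \<in> P" "y \<noteq> \<one>" using PG subgroup.one_closed by blast
  then show ?thesis using that pow_card_one[OF fin PG(1)] P(2) PG by auto
qed

text \<open>A Sylow p-subgroup of H consists of p-elements, hence lies in U, so the full power of p
  in |H| already divides |U|. With \<open>subgroup_eq_of_index\<close> this proves equality of
  subgroups one prime at a time.\<close>

lemma not_prime_dvd_index:
  assumes fin: "finite (carrier G)" and H: "subgroup H G" and U: "subgroup U G" "U \<subseteq> H" and p: "nat_prime p"
    and mem: "\<And>x n. x \<in> H \<Longrightarrow> x [^] (p ^ n :: nat) = \<one> \<Longrightarrow> x \<in> U"
  shows "\<not> p dvd card H div card U"
proof
  assume dvd: "p dvd card H div card U"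
  interpret H: group "G\<lparr>carrier := H\<rparr>" using H by (simp add: subgroup_imp_group)
  have finH: "finite H" using fin H finite_subset subgroup.subset by blast
  define a where "a = multiplicity p (card H)"
  obtain m where m: "card H = p ^ a * m" unfolding a_def using multiplicity_dvd by blast
  obtain P where P: "subgroup P (G\<lparr>carrier := H\<rparr>)" "card P = p ^ a"
    using sylow_thm[of p "G\<lparr>carrier := H\<rparr>" a m] p H.is_group finH m by (auto simp: order_def)
  have PG: "subgroup P G" "P \<subseteq> H" using P H incl_subgroup subgroup.subset[OF P(1)] by auto
  have "P \<subseteq> U" using mem pow_card_one[OF fin PG(1)] PG(2) P(2) by auto
  then have "p ^ a dvd card U" using card_subgroup_mono_dvd[OF fin PG(1) U(1)] P by simp
  moreover have "card H = card U * (card H div card U)"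
    using card_subgroup_mono_dvd[OF fin U(1) H U(2)] by simp
  ultimately have "p ^ a * p dvd card H" using dvd by (metis mult_dvd_mono)
  then have "p ^ Suc a dvd card H" by (simp add: mult.commute)
  then show False using p card_subgroup_pos[OF fin H] unfolding a_def
    by (metis power_dvd_iff_le_multiplicity not_less_eq_eq order_refl not_prime_unit less_numeral_extra(3))
qed

lemma subgroup_eq_of_index:
  assumes fin: "finite (carrier G)" and H: "subgroup H G" and U: "subgroup U G" "U \<subseteq> H"
    and "\<And>p. nat_prime p \<Longrightarrow> \<not> p dvd card H div card U"
  shows "U = H"
proof -
  have "card H div card U = 1" using assms(5) prime_factor_nat by blast
  then have "card H = card U" using card_subgroup_mono_dvd[OF fin U(1) H U(2)]
    by (metis dvd_mult_div_cancel mult.right_neutral)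
  then show ?thesis using U(2) fin H by (metis card_subset_eq finite_subset subgroup.subset)
qed

lemma pow_index_mem:
  assumes fin: "finite (carrier G)" and N: "N \<lhd> G" and x: "x \<in> carrier G"
  shows "x [^] (order G div card N) \<in> N"
proof -
  interpret N: normal N G by (rule N)
  interpret Q: group "G Mod N" by (rule N.factorgroup_is_group)
  have "order (G Mod N) * card N = order G"
    using lagrange[OF N.is_subgroup] by (simp add: order_def FactGroup_def)
  then have "order (G Mod N) = order G div card N"
    using card_subgroup_pos[OF fin N.is_subgroup] by (metis nonzero_mult_div_cancel_right not_less_zero)
  then have "N #> x [^] (order G div card N) = N"
    using Q.pow_order_eq_1[of "N #> x"] N.FactGroup_pow[OF x] x by (auto simp: carrier_FactGroup)
  then show ?thesis using N.is_subgroup x by (meson coset_join1 N.subset nat_pow_closed)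
qed

lemma pow_one_normal_mem:
  assumes "finite (carrier G)" "N \<lhd> G" "x \<in> carrier G" "x [^] (m::nat) = \<one>" "coprime m (order G div card N)"
  shows "x \<in> N"
  using pow_coprime_mem[of N x m "order G div card N"] pow_index_mem[OF assms(1-3)] assms
    normal_imp_subgroup[OF assms(2)] subgroup.one_closed by metis

text \<open>Counts the fibres of multiplication on pairs from H and K: the fibre over h k consists
  of the pairs (h d, d^-1 k) with d in H \<inter> K.\<close>

lemma card_set_mult_Int:
  assumes fin: "finite (carrier G)" and H: "subgroup H G" and K: "subgroup K G"
  shows "card (H <#> K) * card (H \<inter> K) = card H * card K"
proof -
  have finHK: "finite H" "finite K" using fin H K finite_subset subgroup.subset by blast+
  have sub: "H \<subseteq> carrier G" "K \<subseteq> carrier G" using H K subgroup.subset by auto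
  define f where "f = (\<lambda>(h, k). h \<otimes> k)"
  have img: "H <#> K = f ` (H \<times> K)" by (force simp: f_def set_mult_def)
  have fib: "card {z \<in> H \<times> K. f z = y} = card (H \<inter> K)" if "y \<in> H <#> K" for y
  proof -
    obtain h k where y: "h \<in> H" "k \<in> K" "y = h \<otimes> k" using \<open>y \<in> H <#> K\<close> by (auto simp: set_mult_def)
    have "bij_betw (\<lambda>d. (h \<otimes> d, inv d \<otimes> k)) (H \<inter> K) {z \<in> H \<times> K. f z = y}"
    proof (rule bij_betwI')
      fix d d' assume "d \<in> H \<inter> K" "d' \<in> H \<inter> K"
      then show "((h \<otimes> d, inv d \<otimes> k) = (h \<otimes> d', inv d' \<otimes> k)) = (d = d')"
        using y sub by (auto simp: subset_iff)
    next
      fix d assume d: "d \<in> H \<inter> K"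
      have c: "h \<in> carrier G" "d \<in> carrier G" "k \<in> carrier G" using d y sub by auto
      then have "d \<otimes> (inv d \<otimes> k) = k" by (simp add: m_assoc[symmetric])
      then have "h \<otimes> d \<otimes> (inv d \<otimes> k) = h \<otimes> k" using c by (simp add: m_assoc)
      then show "(h \<otimes> d, inv d \<otimes> k) \<in> {z \<in> H \<times> K. f z = y}"
        using d y H K by (auto simp: f_def subgroup.m_closed subgroup.m_inv_closed)
    next
      fix z assume "z \<in> {z \<in> H \<times> K. f z = y}"
      then obtain h' k' where z: "z = (h', k')" "h' \<in> H" "k' \<in> K" "h' \<otimes> k' = h \<otimes> k"
        using y by (auto simp: f_def)
      have c: "h \<in> carrier G" "h' \<in> carrier G" "k \<in> carrier G" "k' \<in> carrier G" using z y sub by auto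
      define d where "d = inv h \<otimes> h'"
      have dc: "d \<in> carrier G" using c by (simp add: d_def)
      have h': "h \<otimes> d = h'" using c by (simp add: d_def m_assoc[symmetric])
      then have "h \<otimes> (d \<otimes> k') = h \<otimes> k" using z(4) c dc by (simp add: m_assoc[symmetric])
      then have dk: "d \<otimes> k' = k" using c dc by simp
      then have "d = k \<otimes> inv k'" using c dc by (metis inv_solve_right)
      then have "d \<in> K" using z y K by (simp add: subgroup.m_closed subgroup.m_inv_closed)
      moreover have "d \<in> H" using z y H by (simp add: d_def subgroup.m_closed subgroup.m_inv_closed)
      moreover have "inv d \<otimes> k = k'" using dk c dc by (metis inv_solve_left)
      ultimately show "\<exists>d\<in>H \<inter> K. z = (h \<otimes> d, inv d \<otimes> k)" using z h' by auto
    qed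
    then show ?thesis using bij_betw_same_card by fastforce
  qed
  have "card H * card K = card (H \<times> K)" by (simp add: card_cartesian_product)
  also have "H \<times> K = (\<Union>y\<in>H <#> K. {z \<in> H \<times> K. f z = y})" using img by auto
  also have "card \<dots> = (\<Sum>y\<in>H <#> K. card {z \<in> H \<times> K. f z = y})"
    by (rule card_UN_disjoint) (use finHK img in auto)
  also have "\<dots> = card (H <#> K) * card (H \<inter> K)" using fib by simp
  finally show ?thesis by simp
qed

end

section \<open>Conjugation, permuting subgroups and commutators\<close>

lemma (in group) conj_pow:
  assumes "g \<in> carrier G" "x \<in> carrier G"
  shows "(g \<otimes> x \<otimes> inv g) [^] (n::nat) = g \<otimes> x [^] n \<otimes> inv g"
proof (induction n)
  case (Suc n)
  have "g \<otimes> x [^] n \<otimes> inv g \<otimes> (g \<otimes> x \<otimes> inv g) = g \<otimes> x [^] n \<otimes> (inv g \<otimes> g) \<otimes> x \<otimes> inv g"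
    using assms by (simp only: m_assoc m_closed inv_closed nat_pow_closed)
  then show ?case using assms Suc by (simp add: m_assoc)
qed (use assms in simp)

lemma (in group) subgroup_set_mult_commute:
  assumes H: "subgroup H G" and K: "subgroup K G" and eq: "H <#> K = K <#> H"
  shows "subgroup (H <#> K) G"
proof (rule subgroupI)
  have sub: "H \<subseteq> carrier G" "K \<subseteq> carrier G" using H K subgroup.subset by auto
  show "H <#> K \<subseteq> carrier G" using sub by (rule setmult_subset_G)
  show "H <#> K \<noteq> {}" using subgroup.one_closed[OF H] subgroup.one_closed[OF K] by (auto simp: set_mult_def)
  show "inv a \<in> H <#> K" if a: "a \<in> H <#> K" for a
  proof -
    obtain h k where hk: "h \<in> H" "k \<in> K" "a = h \<otimes> k" using a by (auto simp: set_mult_def)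
    then have "inv a = inv k \<otimes> inv h" using sub by (auto intro!: inv_mult_group)
    then have "inv a \<in> K <#> H" using hk H K subgroup.m_inv_closed by (fastforce simp: set_mult_def)
    then show ?thesis using eq by simp
  qed
  show "a \<otimes> b \<in> H <#> K" if ab: "a \<in> H <#> K" "b \<in> H <#> K" for a b
  proof -
    obtain h k where hk: "h \<in> H" "k \<in> K" "a = h \<otimes> k" using ab by (auto simp: set_mult_def)
    obtain h' k' where hk': "h' \<in> H" "k' \<in> K" "b = h' \<otimes> k'" using ab by (auto simp: set_mult_def)
    have "k \<otimes> h' \<in> H <#> K" using eq hk hk' by (auto simp: set_mult_def)
    then obtain h'' k'' where 2: "h'' \<in> H" "k'' \<in> K" "k \<otimes> h' = h'' \<otimes> k''" by (auto simp: set_mult_def)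
    have c: "h \<in> carrier G" "k \<in> carrier G" "h' \<in> carrier G" "k' \<in> carrier G" "h'' \<in> carrier G" "k'' \<in> carrier G"
      using hk hk' 2 sub by auto
    have "a \<otimes> b = h \<otimes> (k \<otimes> h') \<otimes> k'" using hk hk' c by (simp add: m_assoc)
    also have "\<dots> = (h \<otimes> h'') \<otimes> (k'' \<otimes> k')" using 2 c by (simp add: m_assoc)
    finally have "a \<otimes> b = (h \<otimes> h'') \<otimes> (k'' \<otimes> k')" .
    moreover have "h \<otimes> h'' \<in> H" "k'' \<otimes> k' \<in> K"
      using hk hk' 2 subgroup.m_closed[OF H] subgroup.m_closed[OF K] by auto
    ultimately show ?thesis by (auto simp: set_mult_def)
  qed
qed

text \<open>Inversion exchanges A K and K A, so it turns one inclusion into the other.\<close>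

lemma (in group) set_mult_commuteI:
  assumes A: "subgroup A G" and K: "subgroup K G" and sub: "A <#> K \<subseteq> K <#> A"
  shows "K <#> A = A <#> K"
proof
  show "K <#> A \<subseteq> A <#> K"
  proof
    fix x assume "x \<in> K <#> A"
    then obtain k a where ka: "k \<in> K" "a \<in> A" "x = k \<otimes> a" by (auto simp: set_mult_def)
    have c: "k \<in> carrier G" "a \<in> carrier G" using ka subgroup.mem_carrier[OF A] subgroup.mem_carrier[OF K] by auto
    have "inv a \<otimes> inv k \<in> A <#> K"
      using ka subgroup.m_inv_closed[OF A] subgroup.m_inv_closed[OF K] by (auto simp: set_mult_def)
    then have "inv a \<otimes> inv k \<in> K <#> A" using sub by blast
    then obtain k' a' where 2: "k' \<in> K" "a' \<in> A" "inv a \<otimes> inv k = k' \<otimes> a'"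
      by (auto simp: set_mult_def)
    have c': "k' \<in> carrier G" "a' \<in> carrier G" using 2 subgroup.mem_carrier[OF A] subgroup.mem_carrier[OF K] by auto
    have "x = inv (inv a \<otimes> inv k)" using c ka by (simp add: inv_mult_group)
    also have "\<dots> = inv a' \<otimes> inv k'" using c' 2(3) by (simp add: inv_mult_group)
    finally show "x \<in> A <#> K"
      using 2 subgroup.m_inv_closed[OF A] subgroup.m_inv_closed[OF K] by (auto simp: set_mult_def)
  qed
qed (rule sub)

lemma (in group) mem_conj_iff:
  assumes "A \<subseteq> carrier G" "x \<in> carrier G"
  shows "y \<in> (inv x <# A) #> x \<longleftrightarrow> (\<exists>a\<in>A. y = inv x \<otimes> a \<otimes> x)"
  by (auto simp: l_coset_def r_coset_def)

lemma (in group) hall_sigma_subgroup_conj: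
  assumes A: "hall_sigma_subgroup t G A" and x: "x \<in> carrier G"
  shows "hall_sigma_subgroup t G ((inv x <# A) #> x)"
proof -
  have sA: "subgroup A G" using A by (simp add: hall_sigma_subgroup_def)
  have sub: "A \<subseteq> carrier G" using sA subgroup.subset by blast
  have eq: "(inv x <# A) #> x = (\<lambda>a. inv x \<otimes> a \<otimes> x) ` A"
    using mem_conj_iff[OF sub x] by auto
  have "(\<lambda>a. inv x \<otimes> a \<otimes> x) \<in> hom G G"
  proof (rule homI)
    fix a b assume "a \<in> carrier G" "b \<in> carrier G"
    then have "inv x \<otimes> a \<otimes> x \<otimes> (inv x \<otimes> b \<otimes> x) = inv x \<otimes> a \<otimes> (x \<otimes> inv x) \<otimes> b \<otimes> x"
      using x by (simp only: m_assoc m_closed inv_closed)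
    then show "inv x \<otimes> (a \<otimes> b) \<otimes> x = inv x \<otimes> a \<otimes> x \<otimes> (inv x \<otimes> b \<otimes> x)"
      using x \<open>a \<in> carrier G\<close> \<open>b \<in> carrier G\<close> by (simp add: m_assoc)
  qed (use x in simp)
  then interpret h: group_hom G G "\<lambda>a. inv x \<otimes> a \<otimes> x"
    by unfold_locales
  have "inj_on (\<lambda>a. inv x \<otimes> a \<otimes> x) A"
    using sub x by (auto simp: inj_on_def subset_iff)
  then have "card ((inv x <# A) #> x) = card A" by (simp add: eq card_image)
  moreover have "subgroup ((inv x <# A) #> x) G" using h.subgroup_img_is_subgroup[OF sA] eq by simp
  ultimately show ?thesis using A by (simp add: hall_sigma_subgroup_def)
qed

text \<open>Here c is the commutator [r, k]. If it commutes with k, moving r past k^t costs exactly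
  c^t, so k^t = 1 forces c^t = 1. This is the computation behind the coprime action
  argument.\<close>

lemma (in group) commuting_step_pow:
  assumes c: "r \<in> carrier G" "k \<in> carrier G" "c \<in> carrier G"
    and rk: "r \<otimes> k = k \<otimes> r \<otimes> c" and kc: "k \<otimes> c = c \<otimes> k"
  shows "r \<otimes> k [^] (t::nat) = k [^] t \<otimes> r \<otimes> c [^] t"
proof (induction t)
  case (Suc t)
  have ck: "c [^] t \<otimes> k = k \<otimes> c [^] t"
    using c kc by (induction t) (simp_all add: m_assoc, metis m_assoc nat_pow_closed)
  have "r \<otimes> k [^] Suc t = k [^] t \<otimes> r \<otimes> (c [^] t \<otimes> k)"
    using c Suc by (simp add: m_assoc[symmetric])
  also have "\<dots> = k [^] t \<otimes> (r \<otimes> k) \<otimes> c [^] t"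
    using c by (simp add: ck m_assoc)
  also have "\<dots> = k [^] t \<otimes> k \<otimes> r \<otimes> (c \<otimes> c [^] t)"
    using c by (simp add: rk m_assoc)
  also have "c \<otimes> c [^] t = c [^] Suc t" using c by (simp add: nat_pow_comm[of c 1, simplified])
  finally show ?case by simp
qed (use c in simp)

context normal
begin

lemma rcos_eq_self_iff: "x \<in> carrier G \<Longrightarrow> H #> x = H \<longleftrightarrow> x \<in> H"
  using coset_join1 coset_join2 is_subgroup subset by blast

lemma rcos_group_hom: "group_hom G (G Mod H) ((#>) H)"
  using r_coset_hom_Mod factorgroup_is_group by (simp add: group_hom_def group_hom_axioms_def is_group)

end

text \<open>Supplies the product closure that \<open>primary_induct\<close> asks for, for the
  elements centralizing k modulo N.\<close>

lemma (in group) commute_mod_closed: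
  assumes N: "N \<lhd> G" and c: "k \<in> carrier G" "x \<in> carrier G" "y \<in> carrier G"
    and "N #> (k \<otimes> x) = N #> (x \<otimes> k)" "N #> (k \<otimes> y) = N #> (y \<otimes> k)"
  shows "N #> (k \<otimes> (x \<otimes> y)) = N #> (x \<otimes> y \<otimes> k)"
proof -
  interpret N: normal N G by (rule N)
  interpret Q: group "G Mod N" by (rule N.factorgroup_is_group)
  interpret h: group_hom G "G Mod N" "(#>) N" by (rule N.rcos_group_hom)
  have "N #> (k \<otimes> (x \<otimes> y)) = N #> (k \<otimes> x \<otimes> y)" using c by (simp add: m_assoc)
  also have "\<dots> = (N #> (k \<otimes> x)) \<otimes>\<^bsub>G Mod N\<^esub> (N #> y)" using c by (intro h.hom_mult) auto
  also have "\<dots> = N #> (x \<otimes> k \<otimes> y)" unfolding assms(5) using c by (intro h.hom_mult[symmetric]) auto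
  also have "\<dots> = N #> (x \<otimes> (k \<otimes> y))" using c by (simp add: m_assoc)
  also have "\<dots> = (N #> x) \<otimes>\<^bsub>G Mod N\<^esub> (N #> (k \<otimes> y))" using c by (intro h.hom_mult) auto
  also have "\<dots> = N #> (x \<otimes> (y \<otimes> k))" unfolding assms(6) using c by (intro h.hom_mult[symmetric]) auto
  finally show ?thesis using c by (simp add: m_assoc)
qed

section \<open>Groups with a Hall subgroup of power type\<close>

text \<open>For normal N this is the set of elements whose image modulo N has s-number order.\<close>

definition pi_roots :: "('a, 'b) monoid_scheme \<Rightarrow> nat set \<Rightarrow> 'a set \<Rightarrow> 'a set" where
  "pi_roots G s N = {x \<in> carrier G. \<exists>m>0. s_number s m \<and> x [^]\<^bsub>G\<^esub> (m::nat) \<in> N}"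

text \<open>The last two assumptions encode that G / R is \<sigma>-nilpotent and that the part of R
  in a class t has a normal complement in the Hall t-subgroups.\<close>

locale power_hall = group G for G (structure) +
  fixes \<Sigma> :: "nat set set" and R
  assumes part: "partition_on primes_set \<Sigma>"
    and fin: "finite (carrier G)"
    and R_normal: "R \<lhd> G"
    and R_hall: "\<lbrakk>nat_prime p; p dvd card R; x \<in> carrier G; x [^] (p ^ n :: nat) = \<one>\<rbrakk> \<Longrightarrow> x \<in> R"
    and R_power: "\<lbrakk>x \<in> R; g \<in> carrier G\<rbrakk> \<Longrightarrow> \<exists>n::nat. inv g \<otimes> x \<otimes> g = x [^] n"
    and roots: "t \<in> \<Sigma> \<Longrightarrow> subgroup (pi_roots G t R) G"
    and primary_commute: "\<lbrakk>t \<in> \<Sigma>; nat_prime p; nat_prime q; p \<in> t; q \<in> t; p \<noteq> q;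
      k \<in> carrier G; k [^] (p ^ m :: nat) = \<one>; r \<in> R; r [^] (q ^ n :: nat) = \<one>\<rbrakk> \<Longrightarrow> k \<otimes> r = r \<otimes> k"
begin

lemma R_sub: "subgroup R G"
  using R_normal by (rule normal_imp_subgroup)

lemma R_carrier: "x \<in> R \<Longrightarrow> x \<in> carrier G"
  using subgroup.mem_carrier[OF R_sub] .

lemma normal_of_subset_R:
  assumes V: "subgroup V G" "V \<subseteq> R"
  shows "V \<lhd> G"
proof (rule normal_invI[OF V(1)])
  fix x h assume x: "x \<in> carrier G" and h: "h \<in> V"
  then obtain n where "inv (inv x) \<otimes> h \<otimes> inv x = h [^] (n::nat)" using R_power[of h "inv x"] V by auto
  then show "x \<otimes> h \<otimes> inv x \<in> V" using subgroup_nat_pow_closed[OF V(1) h] x by simp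
qed

lemma prime_class: 
  assumes "nat_prime p" obtains t where "t \<in> \<Sigma>" "p \<in> t"
  using part assms by (auto simp: partition_on_def primes_set_def)

lemma class_disjoint: "\<lbrakk>s \<in> \<Sigma>; t \<in> \<Sigma>; s \<noteq> t; p \<in> s\<rbrakk> \<Longrightarrow> p \<notin> t"
  using part using partition_onD2[of primes_set \<Sigma>] unfolding disjoint_def by blast

text \<open>With N = H \<inter> R and B = H \<inter> A, the subgroup N B fills T, the set of
  t-elements modulo R in H. For primes in t, the index of N B in T divides |H : B| = |HA : A|, which
  divides |G : A| and so has no prime in t. For p outside t, every p-element of T lies in R, hence
  in N.\<close>

lemma hall_decomp:
  assumes H: "subgroup H G" and A: "hall_sigma_subgroup t G A" and HA: "H <#> A = A <#> H"
    and t: "t \<in> \<Sigma>" and k: "k \<in> H" "k \<in> pi_roots G t R"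
  obtains a n where "a \<in> A" "n \<in> H \<inter> R" "k = a \<otimes> n"
proof -
  define T where "T = pi_roots G t R \<inter> H"
  define B where "B = H \<inter> A"
  define N where "N = H \<inter> R"
  have sA: "subgroup A G" using A by (simp add: hall_sigma_subgroup_def)
  have sT: "subgroup T G" and sB: "subgroup B G" and sN: "subgroup N G"
    unfolding T_def B_def N_def using subgroups_Inter_pair roots[OF t] H sA R_sub by auto
  have N: "N \<lhd> G" using normal_of_subset_R[OF sN] by (simp add: N_def)
  have sU: "subgroup (N <#> B) G" using mult_norm_subgroup[OF N sB] .
  have BT: "B \<subseteq> T"
  proof
    fix b assume b: "b \<in> B"
    then have "b [^] card A = \<one>" using pow_card_one[OF fin sA] by (simp add: B_def)
    then show "b \<in> T"
      using b A card_subgroup_pos[OF fin sA] subgroup.one_closed[OF R_sub] subgroup.mem_carrier[OF sB]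
      by (auto simp: T_def B_def pi_roots_def hall_sigma_subgroup_def intro!: exI[of _ "card A"])
  qed
  have NT: "N \<subseteq> T"
  proof
    fix b assume b: "b \<in> N"
    then show "b \<in> T" using R_carrier[of b]
      by (auto simp: T_def N_def pi_roots_def s_number_def intro!: exI[of _ 1])
  qed
  have UT: "N <#> B \<subseteq> T" using NT BT subgroup.m_closed[OF sT] by (auto simp: set_mult_def)
  have NU: "N \<subseteq> N <#> B"
  proof
    fix n assume "n \<in> N"
    then have "n \<otimes> \<one> \<in> N <#> B" using subgroup.one_closed[OF sB] by (auto simp: set_mult_def)
    then show "n \<in> N <#> B" using \<open>n \<in> N\<close> subgroup.mem_carrier[OF sN] by simp
  qed
  have BU: "B \<subseteq> N <#> B"
  proof
    fix b assume "b \<in> B"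
    then have "\<one> \<otimes> b \<in> N <#> B" using subgroup.one_closed[OF sN] by (auto simp: set_mult_def)
    then show "b \<in> N <#> B" using \<open>b \<in> B\<close> subgroup.mem_carrier[OF sB] by simp
  qed
  have "N <#> B = T"
  proof (rule subgroup_eq_of_index[OF fin sT sU UT])
    fix p assume p: "nat_prime p"
    show "\<not> p dvd card T div card (N <#> B)"
    proof (cases "p \<in> t")
      case True
      obtain c where c: "card H = card B * c"
        using card_subgroup_mono_dvd[OF fin sB H] by (auto simp: B_def)
      obtain b where b: "card (N <#> B) = card B * b"
        using card_subgroup_mono_dvd[OF fin sB sU BU] by auto
      obtain u where u: "card T = card (N <#> B) * u"
        using card_subgroup_mono_dvd[OF fin sU sT UT] by auto
      obtain h where h: "card H = card T * h"
        using card_subgroup_mono_dvd[OF fin sT H] by (auto simp: T_def)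
      have "card (H <#> A) * card B = card H * card A"
        using card_set_mult_Int[OF fin H sA] by (simp add: B_def)
      then have HAc: "card (H <#> A) = card A * c" using c card_subgroup_pos[OF fin sB] by simp
      obtain d where "order G = card (H <#> A) * d"
        using card_subgroup_dvd[OF fin subgroup_set_mult_commute[OF H sA HA]] by auto
      then have ind: "order G div card A = c * d" using HAc card_subgroup_pos[OF fin sA] by simp
      have "card B * c = card B * (b * u * h)" using c b u h by (metis mult.assoc)
      then have "c = b * u * h" using card_subgroup_pos[OF fin sB] by simp
      moreover have "card T div card (N <#> B) = u" using u card_subgroup_pos[OF fin sU] by simp
      moreover have "\<not> p dvd c * d"
      proof
        assume "p dvd c * d"
        moreover have "c * d \<noteq> 0" using \<open>order G = card (H <#> A) * d\<close> HAc fin order_gt_0_iff_finite by fastforce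
        ultimately have "p \<in> prime_factors (order G div card A)" using p ind by (simp add: in_prime_factors_iff)
        then show False using A True by (auto simp: hall_sigma_subgroup_def)
      qed
      ultimately show ?thesis by auto
    next
      case False
      show ?thesis
      proof (rule not_prime_dvd_index[OF fin sT sU UT p])
        fix x n assume x: "x \<in> T" "x [^] (p ^ n :: nat) = \<one>"
        then obtain m where m: "m > 0" "s_number t m" "x [^] m \<in> R" by (auto simp: T_def pi_roots_def)
        have "coprime (p ^ n) m" using coprime_prime_power p s_number_prime_dvd[OF m(2,1) p] False by blast
        then have "x \<in> R"
          using pow_coprime_mem[OF R_sub, of x "p ^ n" m] x m subgroup.mem_carrier[OF sT] subgroup.one_closed[OF R_sub] by auto
        then show "x \<in> N <#> B" using x NU by (auto simp: N_def T_def)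
      qed
    qed
  qed
  then have "k \<in> B <#> N" using k commut_normal[OF sB N] by (auto simp: T_def)
  then show ?thesis using that by (auto simp: set_mult_def B_def N_def)
qed

text \<open>Let t be the class of p and y in R an element of q-power order. If q is in t, then q
  differs from p because p does not divide |R|, and \<open>primary_commute\<close> applies.
  Otherwise k and y k y^-1 reduce modulo N = H \<inter> R into one Hall t-subgroup A, and so does
  the commutator c. As c is also a q-element and q does not divide |A|, c lies in N.\<close>

lemma quasinormal_commute:
  assumes qn: "sigma_quasinormal \<Sigma> G H" and k: "k \<in> H" "nat_prime p" "\<not> p dvd card R" "k [^] (p ^ m :: nat) = \<one>"
    and r: "r \<in> R"
  shows "(H \<inter> R) #> (k \<otimes> r) = (H \<inter> R) #> (r \<otimes> k)"
proof (cases "k = \<one>")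
  case True
  then show ?thesis using R_carrier[OF r] by simp
next
  case False
  define N where "N = H \<inter> R"
  have H: "subgroup H G" using qn by (simp add: sigma_quasinormal_def)
  have kc: "k \<in> carrier G" using subgroup.mem_carrier[OF H k(1)] .
  have sN: "subgroup N G" unfolding N_def using subgroups_Inter_pair H R_sub by blast
  have N: "N \<lhd> G" using normal_of_subset_R[OF sN] by (simp add: N_def)
  interpret N: normal N G by (rule N)
  interpret Q: group "G Mod N" by (rule N.factorgroup_is_group)
  interpret h: group_hom G "G Mod N" "(#>) N" by (rule N.rcos_group_hom)
  obtain t where t: "t \<in> \<Sigma>" "p \<in> t" using prime_class[OF k(2)] .
  obtain \<H> where \<H>: "complete_hall_sigma_set \<Sigma> G \<H>"
    and perm: "\<And>A x. A \<in> \<H> \<Longrightarrow> x \<in> carrier G \<Longrightarrow>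
      H <#> ((inv x <# A) #> x) = ((inv x <# A) #> x) <#> H"
    using qn unfolding sigma_quasinormal_def by blast
  have "p dvd order G" using prime_dvd_card_subgroup[OF fin subgroup_self kc False k(2,4)] by (simp add: order_def)
  then have "t \<in> sigma_of_group \<Sigma> G"
    using t k(2) fin order_gt_0_iff_finite
    unfolding sigma_of_group_def sigma_of_nat_def
    by (metis (mono_tags, lifting) IntI empty_iff in_prime_factors_iff mem_Collect_eq not_gr_zero)
  then obtain A where A: "A \<in> \<H>" "hall_sigma_subgroup t G A"
    using \<H> unfolding complete_hall_sigma_set_def by metis
  have sA: "subgroup A G" using A by (simp add: hall_sigma_subgroup_def)
  have Ac: "A \<subseteq> carrier G" using sA subgroup.subset by blast
  have kroot: "k \<in> pi_roots G t R"
    using kc k(4) s_number_prime_power[OF k(2) t(2)] prime_gt_0_nat[OF k(2)] subgroup.one_closed[OF R_sub]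
    by (auto simp: pi_roots_def intro!: exI[of _ "p ^ m"])
  \<comment> \<open>Permutability of H with the conjugate x^-1 A x decomposes k; conjugating back by
    x keeps A fixed and moves k instead, and N is normal.\<close>
  have decomp: "\<exists>a\<in>A. \<exists>n\<in>N. x \<otimes> k \<otimes> inv x = a \<otimes> n" if x: "x \<in> carrier G" for x
  proof -
    obtain a n where an: "a \<in> (inv x <# A) #> x" "n \<in> N" "k = a \<otimes> n"
      using hall_decomp[OF H hall_sigma_subgroup_conj[OF A(2) x] perm[OF A(1) x] t(1) k(1) kroot]
      unfolding N_def by blast
    obtain b where b: "b \<in> A" "a = inv x \<otimes> b \<otimes> x" using an mem_conj_iff[OF Ac x] by blast
    have bc: "b \<in> carrier G" using b Ac by auto
    have nc: "n \<in> carrier G" using an(2) N.mem_carrier by blast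
    have "x \<otimes> k \<otimes> inv x = (x \<otimes> inv x) \<otimes> b \<otimes> (x \<otimes> n \<otimes> inv x)"
      unfolding an(3) b(2) using x bc nc by (simp only: m_assoc m_closed inv_closed)
    then have "x \<otimes> k \<otimes> inv x = b \<otimes> (x \<otimes> n \<otimes> inv x)" using x bc nc by simp
    then show ?thesis using b N.inv_op_closed2[OF x an(2)] by blast
  qed
  have "r \<in> {y \<in> R. N #> (k \<otimes> y) = N #> (y \<otimes> k)}"
  proof (rule primary_induct[OF fin R_carrier[OF r]])
    fix y z assume "y \<in> {y \<in> R. N #> (k \<otimes> y) = N #> (y \<otimes> k)}" "z \<in> {y \<in> R. N #> (k \<otimes> y) = N #> (y \<otimes> k)}"
    then show "y \<otimes> z \<in> {y \<in> R. N #> (k \<otimes> y) = N #> (y \<otimes> k)}"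
      using commute_mod_closed[OF N kc] R_carrier subgroup.m_closed[OF R_sub] by auto
  next
    fix i q n assume q: "nat_prime q" and qn: "(r [^] (i::nat)) [^] (q ^ n :: nat) = \<one>"
    define y where "y = r [^] i"
    have yR: "y \<in> R" unfolding y_def by (rule subgroup_nat_pow_closed[OF R_sub r])
    have yc: "y \<in> carrier G" using R_carrier[OF yR] .
    have yq: "y [^] (q ^ n) = \<one>" using qn by (simp add: y_def)
    have "N #> (k \<otimes> y) = N #> (y \<otimes> k)"
    proof (cases "y = \<one> \<or> q \<in> t")
      case True
      then show ?thesis
      proof
        assume "q \<in> t"
        show ?thesis
        proof (cases "y = \<one>")
          case False
          then have "q dvd card R" using prime_dvd_card_subgroup[OF fin R_sub yR _ q yq] by blast
          then have "p \<noteq> q" using k(3) by auto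
          then have "k \<otimes> y = y \<otimes> k" using primary_commute[OF t(1) k(2) q t(2) \<open>q \<in> t\<close> _ kc k(4) yR yq] by blast
          then show ?thesis by simp
        qed (use kc in simp)
      qed (use kc in simp)
    next
      case False
      obtain a1 n1 where 1: "a1 \<in> A" "n1 \<in> N" "k = a1 \<otimes> n1"
        using decomp[of \<one>] kc by auto
      obtain a2 n2 where 2: "a2 \<in> A" "n2 \<in> N" "y \<otimes> k \<otimes> inv y = a2 \<otimes> n2"
        using decomp[OF yc] by auto
      have cs: "a1 \<in> carrier G" "a2 \<in> carrier G" "n1 \<in> carrier G" "n2 \<in> carrier G"
        using 1 2 Ac N.mem_carrier by auto
      define c where "c = inv k \<otimes> y \<otimes> k \<otimes> inv y"
      have cc: "c \<in> carrier G" using kc yc by (simp add: c_def)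
      \<comment> \<open>Conjugation by k sends y to a power of y, so c is a product of two commuting
        factors that are both killed by q^n.\<close>
      have cq: "c [^] (q ^ n) = \<one>"
      proof -
        obtain j where j: "inv k \<otimes> y \<otimes> k = y [^] (j::nat)" using R_power[OF yR kc] by blast
        have jj: "y [^] j \<otimes> inv y = inv y \<otimes> y [^] j"
        proof -
          have "y \<otimes> y [^] j = y [^] j \<otimes> y" using nat_pow_comm[OF yc, of 1 j] yc by simp
          then show ?thesis using yc by (metis inv_solve_left inv_solve_right m_assoc inv_closed nat_pow_closed m_closed)
        qed
        have "c [^] (q ^ n) = (y [^] j) [^] (q ^ n) \<otimes> (inv y) [^] (q ^ n)"
          unfolding c_def j by (rule pow_mult_distrib[OF jj]) (use yc in auto)
        also have "(y [^] j) [^] (q ^ n) = (y [^] (q ^ n)) [^] j" using yc by (simp add: nat_pow_pow mult.commute)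
        finally show ?thesis using yc yq by (simp add: nat_pow_inv)
      qed
      have "N #> c = N #> (inv a1 \<otimes> a2)"
      proof -
        have "c = inv k \<otimes> (y \<otimes> k \<otimes> inv y)" using kc yc by (simp add: c_def m_assoc)
        then have "N #> c = inv\<^bsub>G Mod N\<^esub> (N #> k) \<otimes>\<^bsub>G Mod N\<^esub> (N #> (a2 \<otimes> n2))"
          using kc yc 2 cs by (simp only: h.hom_mult h.hom_inv inv_closed m_closed)
        also have "N #> (a2 \<otimes> n2) = (N #> a2) \<otimes>\<^bsub>G Mod N\<^esub> (N #> n2)" using cs by (intro h.hom_mult) auto
        also have "N #> n2 = \<one>\<^bsub>G Mod N\<^esub>" using N.rcos_eq_self_iff[OF cs(4)] 2 by simp
        also have "(N #> a2) \<otimes>\<^bsub>G Mod N\<^esub> \<one>\<^bsub>G Mod N\<^esub> = N #> a2" using cs by (intro Q.r_one h.hom_closed)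
        also have "N #> k = N #> a1"
        proof -
          have "N #> k = (N #> a1) \<otimes>\<^bsub>G Mod N\<^esub> (N #> n1)" unfolding 1(3) using cs by (intro h.hom_mult) auto
          also have "N #> n1 = \<one>\<^bsub>G Mod N\<^esub>" using N.rcos_eq_self_iff[OF cs(3)] 1 by simp
          also have "(N #> a1) \<otimes>\<^bsub>G Mod N\<^esub> \<one>\<^bsub>G Mod N\<^esub> = N #> a1" using cs by (intro Q.r_one h.hom_closed)
          finally show ?thesis .
        qed
        also have "inv\<^bsub>G Mod N\<^esub> (N #> a1) \<otimes>\<^bsub>G Mod N\<^esub> (N #> a2) = N #> (inv a1 \<otimes> a2)"
          using cs by (simp only: h.hom_mult h.hom_inv inv_closed m_closed)
        finally show ?thesis .
      qed
      moreover have "(inv a1 \<otimes> a2) [^] card A = \<one>"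
        using pow_card_one[OF fin sA] 1 2 subgroup.m_closed[OF sA] subgroup.m_inv_closed[OF sA] by blast
      ultimately have "N #> (c [^] card A) = N"
        using N.FactGroup_pow[OF cc, of "card A"] N.FactGroup_pow[of "inv a1 \<otimes> a2" "card A"] cs N.subset by simp
      then have "c [^] card A \<in> N" using N.rcos_eq_self_iff cc by simp
      moreover have "coprime (q ^ n) (card A)"
      proof (rule coprime_prime_power[OF q])
        show "\<not> q dvd card A"
          using s_number_prime_dvd[of t "card A" q] A(2) card_subgroup_pos[OF fin sA] q False
          by (auto simp: hall_sigma_subgroup_def)
      qed
      ultimately have "c \<in> N" using pow_coprime_mem[OF sN cc, of "q ^ n" "card A"] cq N.one_closed by simp
      moreover have "k \<otimes> c = y \<otimes> k \<otimes> inv y"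
        using kc yc by (simp add: c_def m_assoc[symmetric])
      then have "k \<otimes> c \<otimes> y = y \<otimes> k" using kc yc by (simp add: m_assoc)
      moreover have "N #> (k \<otimes> c \<otimes> y) = (N #> k) \<otimes>\<^bsub>G Mod N\<^esub> (N #> c) \<otimes>\<^bsub>G Mod N\<^esub> (N #> y)"
        using kc yc cc by (simp only: h.hom_mult m_closed)
      moreover have "N #> c = \<one>\<^bsub>G Mod N\<^esub>" using N.rcos_eq_self_iff[OF cc] \<open>c \<in> N\<close> by simp
      moreover have "(N #> k) \<otimes>\<^bsub>G Mod N\<^esub> \<one>\<^bsub>G Mod N\<^esub> = N #> k" using kc by (intro Q.r_one h.hom_closed)
      moreover have "(N #> k) \<otimes>\<^bsub>G Mod N\<^esub> (N #> y) = N #> (k \<otimes> y)" using kc yc by (intro h.hom_mult[symmetric]) auto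
      ultimately show ?thesis by metis
    qed
    then show "r [^] i \<in> {y \<in> R. N #> (k \<otimes> y) = N #> (y \<otimes> k)}" using yR by (simp add: y_def)
  qed
  then show ?thesis by (simp add: N_def)
qed

end

section \<open>Passage to subgroups and to chains of quasinormal subgroups\<close>

lemma (in group) pi_roots_restrict:
  assumes "subgroup H G"
  shows "pi_roots (G\<lparr>carrier := H\<rparr>) s (N \<inter> H) = pi_roots G s N \<inter> H"
  using subgroup_nat_pow_closed[OF assms] subgroup.mem_carrier[OF assms]
  by (auto simp: pi_roots_def nat_pow_consistent[symmetric])

context power_hall
begin

text \<open>Powers, inverses and conjugates are the same in H. The Hall condition survives because
  |R \<inter> H| divides |R|, and \<open>roots\<close> survives because taking roots commutes with
  intersecting with H.\<close>

lemma restrict_subgroup: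
  assumes H: "subgroup H G"
  shows "power_hall (G\<lparr>carrier := H\<rparr>) \<Sigma> (R \<inter> H)"
proof -
  interpret H: group "G\<lparr>carrier := H\<rparr>" using H by (rule subgroup_imp_group)
  have Hc: "\<And>x. x \<in> H \<Longrightarrow> x \<in> carrier G" using subgroup.mem_carrier[OF H] .
  have sRH: "subgroup (R \<inter> H) G" using subgroups_Inter_pair R_sub H by blast
  have dvd: "card (R \<inter> H) dvd card R" using card_subgroup_mono_dvd[OF fin sRH R_sub] by simp
  show ?thesis
  proof (intro power_hall.intro power_hall_axioms.intro H.is_group)
    show "partition_on primes_set \<Sigma>" by (rule part)
    show "finite (carrier (G\<lparr>carrier := H\<rparr>))" using fin subgroup.subset[OF H] finite_subset by auto
    show "R \<inter> H \<lhd> G\<lparr>carrier := H\<rparr>" using normal_Int_subgroup[OF H R_normal] .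
  next
    fix p x n assume "nat_prime p" "p dvd card (R \<inter> H)" "x \<in> carrier (G\<lparr>carrier := H\<rparr>)"
      "x [^]\<^bsub>G\<lparr>carrier := H\<rparr>\<^esub> (p ^ n :: nat) = \<one>\<^bsub>G\<lparr>carrier := H\<rparr>\<^esub>"
    then show "x \<in> R \<inter> H"
      using R_hall[of p x n] dvd_trans[OF _ dvd] Hc by (auto simp: nat_pow_consistent[symmetric])
  next
    fix x g assume "x \<in> R \<inter> H" "g \<in> carrier (G\<lparr>carrier := H\<rparr>)"
    then show "\<exists>n::nat. inv\<^bsub>G\<lparr>carrier := H\<rparr>\<^esub> g \<otimes>\<^bsub>G\<lparr>carrier := H\<rparr>\<^esub> x \<otimes>\<^bsub>G\<lparr>carrier := H\<rparr>\<^esub> g = x [^]\<^bsub>G\<lparr>carrier := H\<rparr>\<^esub> n"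
      using R_power[of x g] Hc m_inv_consistent[OF H] by (auto simp: nat_pow_consistent[symmetric])
  next
    fix t assume "t \<in> \<Sigma>"
    then show "subgroup (pi_roots (G\<lparr>carrier := H\<rparr>) t (R \<inter> H)) (G\<lparr>carrier := H\<rparr>)"
      unfolding pi_roots_restrict[OF H]
      by (intro subgroup_incl[OF _ H]) (auto intro: subgroups_Inter_pair roots H)
  next
    fix t p q k m r n
    assume "t \<in> \<Sigma>" "nat_prime p" "nat_prime q" "p \<in> t" "q \<in> t" "p \<noteq> q"
      "k \<in> carrier (G\<lparr>carrier := H\<rparr>)" "k [^]\<^bsub>G\<lparr>carrier := H\<rparr>\<^esub> (p ^ m :: nat) = \<one>\<^bsub>G\<lparr>carrier := H\<rparr>\<^esub>"
      "r \<in> R \<inter> H" "r [^]\<^bsub>G\<lparr>carrier := H\<rparr>\<^esub> (q ^ n :: nat) = \<one>\<^bsub>G\<lparr>carrier := H\<rparr>\<^esub>"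
    then show "k \<otimes>\<^bsub>G\<lparr>carrier := H\<rparr>\<^esub> r = r \<otimes>\<^bsub>G\<lparr>carrier := H\<rparr>\<^esub> k"
      using primary_commute[of t p q k m r n] Hc by (simp add: nat_pow_consistent[symmetric])
  qed
qed

text \<open>\<open>quasinormal_commute\<close> is used twice: in G it puts c = [r, k] into H
  \<inter> R; in H, applied to c, it shows that k and c commute modulo N = K \<inter> R. Then
  c^(p^m) lies in N by \<open>commuting_step_pow\<close>, and c^|R| = 1 with p not dividing |R|
  leaves only c in N.\<close>

lemma quasinormal_trans_commute:
  assumes H: "sigma_quasinormal \<Sigma> G H" and K: "sigma_quasinormal \<Sigma> (G\<lparr>carrier := H\<rparr>) K"
    and k: "k \<in> K" "nat_prime p" "\<not> p dvd card R" "k [^] (p ^ m :: nat) = \<one>" and r: "r \<in> R"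
  shows "(K \<inter> R) #> (k \<otimes> r) = (K \<inter> R) #> (r \<otimes> k)"
proof -
  have sH: "subgroup H G" using H by (simp add: sigma_quasinormal_def)
  have sKH: "subgroup K (G\<lparr>carrier := H\<rparr>)" using K by (simp add: sigma_quasinormal_def)
  have sK: "subgroup K G" using incl_subgroup[OF sH sKH] .
  have KH: "K \<subseteq> H" using subgroup.subset[OF sKH] by simp
  interpret H: power_hall "G\<lparr>carrier := H\<rparr>" \<Sigma> "R \<inter> H" by (rule restrict_subgroup[OF sH])
  define N where "N = K \<inter> R"
  have sN: "subgroup N G" unfolding N_def using subgroups_Inter_pair sK R_sub by blast
  have sM: "subgroup (H \<inter> R) G" using subgroups_Inter_pair sH R_sub by blast
  have N: "N \<lhd> G" using normal_of_subset_R[OF sN] by (simp add: N_def)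
  have M: "H \<inter> R \<lhd> G" using normal_of_subset_R[OF sM] by simp
  interpret N: normal N G by (rule N)
  interpret M: normal "H \<inter> R" G by (rule M)
  interpret Q: group "G Mod N" by (rule N.factorgroup_is_group)
  interpret h: group_hom G "G Mod N" "(#>) N" by (rule N.rcos_group_hom)
  interpret hM: group_hom G "G Mod (H \<inter> R)" "(#>) (H \<inter> R)" by (rule M.rcos_group_hom)
  have kc: "k \<in> carrier G" using subgroup.mem_carrier[OF sK k(1)] .
  have rc: "r \<in> carrier G" using R_carrier[OF r] .
  define c where "c = inv r \<otimes> inv k \<otimes> r \<otimes> k"
  have cc: "c \<in> carrier G" using kc rc by (simp add: c_def)
  have rk: "k \<otimes> r \<otimes> c = r \<otimes> k"
  proof -
    have "k \<otimes> r \<otimes> c = k \<otimes> (r \<otimes> inv r) \<otimes> inv k \<otimes> r \<otimes> k"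
      unfolding c_def using kc rc by (simp only: m_assoc m_closed inv_closed)
    then show ?thesis using kc rc by simp
  qed
  have "(H \<inter> R) #> (k \<otimes> r) = (H \<inter> R) #> (r \<otimes> k)"
    using quasinormal_commute[OF H _ k(2-4) r] k(1) KH by blast
  then have "(H \<inter> R) #> (k \<otimes> r \<otimes> c) = (H \<inter> R) #> (k \<otimes> r)" using rk by simp
  then have cM: "c \<in> H \<inter> R"
    using kc rc cc M.rcos_eq_self_iff[OF cc] hM.hom_mult[of "k \<otimes> r" c]
    by (metis hM.H.l_cancel_one' hM.hom_closed m_closed one_FactGroup)
  have "\<not> p dvd card (R \<inter> H)"
    using k(3) card_subgroup_mono_dvd[OF fin sM R_sub] by (metis Int_commute Int_lower2 dvd_trans)
  then have "(K \<inter> (R \<inter> H)) #> (k \<otimes> c) = (K \<inter> (R \<inter> H)) #> (c \<otimes> k)"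
    using H.quasinormal_commute[OF K k(1,2), of m c] k(4) cM
    by (simp add: nat_pow_consistent[symmetric] Int_commute)
  moreover have "K \<inter> (R \<inter> H) = N" using KH by (auto simp: N_def)
  ultimately have kcc: "N #> (k \<otimes> c) = N #> (c \<otimes> k)" by simp
  have carr: "N #> k \<in> carrier (G Mod N)" "N #> r \<in> carrier (G Mod N)" "N #> c \<in> carrier (G Mod N)"
    using kc rc cc h.hom_closed by auto
  have 1: "(N #> r) \<otimes>\<^bsub>G Mod N\<^esub> (N #> k) = (N #> k) \<otimes>\<^bsub>G Mod N\<^esub> (N #> r) \<otimes>\<^bsub>G Mod N\<^esub> (N #> c)"
    using kc rc cc by (simp only: h.hom_mult[symmetric] m_closed rk)
  have 2: "(N #> k) \<otimes>\<^bsub>G Mod N\<^esub> (N #> c) = (N #> c) \<otimes>\<^bsub>G Mod N\<^esub> (N #> k)"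
    using kc rc cc by (simp only: h.hom_mult[symmetric] m_closed kcc)
  have "(N #> k) [^]\<^bsub>G Mod N\<^esub> (p ^ m) = \<one>\<^bsub>G Mod N\<^esub>"
    using N.FactGroup_pow[OF kc, of "p ^ m"] k(4) N.subset by simp
  then have "(N #> c) [^]\<^bsub>G Mod N\<^esub> (p ^ m) = \<one>\<^bsub>G Mod N\<^esub>"
    using Q.commuting_step_pow[OF carr(2,1,3) 1 2, of "p ^ m"] carr
    by (simp del: mult_FactGroup one_FactGroup)
  then have "c [^] (p ^ m) \<in> N"
    using N.FactGroup_pow[OF cc, of "p ^ m"] N.rcos_eq_self_iff[of "c [^] (p ^ m)"] cc by simp
  moreover have "c [^] card R = \<one>" using pow_card_one[OF fin R_sub] cM by blast
  ultimately have "c \<in> N"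
    using pow_coprime_mem[OF sN cc _ _ coprime_prime_power[OF k(2,3), of m]] N.one_closed by simp
  then have "N #> c = \<one>\<^bsub>G Mod N\<^esub>" using N.rcos_eq_self_iff[OF cc] by simp
  then have "(N #> r) \<otimes>\<^bsub>G Mod N\<^esub> (N #> k) = (N #> k) \<otimes>\<^bsub>G Mod N\<^esub> (N #> r)"
    using 1 carr by (metis Q.m_closed Q.r_one)
  then show ?thesis using h.hom_mult kc rc by (metis N_def)
qed

section \<open>Permutability with the Hall subgroups of G\<close>

text \<open>The cyclic group V generated by r is normal in G, so V A is a subgroup. Its index over A
  divides |V|, a t-number, and also |G : A|, which has no prime divisor in t.\<close>

lemma pi_element_of_R_in_hall:
  assumes A: "hall_sigma_subgroup t G A" and r: "r \<in> R" and e: "r [^] (e::nat) = \<one>" "s_number t e" "e > 0"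
  shows "r \<in> A"
proof -
  have sA: "subgroup A G" using A by (simp add: hall_sigma_subgroup_def)
  have rc: "r \<in> carrier G" using R_carrier[OF r] .
  define V where "V = generate G {r}"
  have sV: "subgroup V G" unfolding V_def using generate_is_subgroup rc by simp
  have rV: "r \<in> V" unfolding V_def by (simp add: generate.incl)
  have VR: "V \<subseteq> R" unfolding V_def using generate_subgroup_incl[OF _ R_sub] r by simp
  have Vn: "V \<lhd> G" using normal_of_subset_R[OF sV VR] .
  have sU: "subgroup (V <#> A) G" using mult_norm_subgroup[OF Vn sA] .
  have AU: "A \<subseteq> V <#> A"
  proof
    fix a assume "a \<in> A"
    then have "\<one> \<otimes> a \<in> V <#> A" using subgroup.one_closed[OF sV] by (auto simp: set_mult_def)
    then show "a \<in> V <#> A" using \<open>a \<in> A\<close> subgroup.mem_carrier[OF sA] by simp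
  qed
  have "ord r dvd e" using e(1) rc pow_eq_id by blast
  then have Vt: "s_number t (card V)"
    using s_number_dvd[OF e(2) _ e(3)] generate_pow_card[OF rc] by (simp add: V_def)
  have "A = V <#> A"
  proof (rule subgroup_eq_of_index[OF fin sU sA AU])
    fix p assume p: "nat_prime p"
    obtain u where u: "card (V <#> A) = card A * u"
      using card_subgroup_mono_dvd[OF fin sA sU AU] by auto
    have ux: "card (V <#> A) div card A = u" using u card_subgroup_pos[OF fin sA] by simp
    have "card (V <#> A) * card (V \<inter> A) = card V * card A" by (rule card_set_mult_Int[OF fin sV sA])
    then have "u * card (V \<inter> A) = card V" using u card_subgroup_pos[OF fin sA] by simp
    then have uV: "u dvd card V" by (metis dvd_triv_left)
    obtain d where d: "order G = card (V <#> A) * d" using card_subgroup_dvd[OF fin sU] by auto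
    have ud: "order G div card A = u * d" using d u card_subgroup_pos[OF fin sA] by simp
    have "u * d \<noteq> 0" using d u fin order_gt_0_iff_finite by fastforce
    show "\<not> p dvd card (V <#> A) div card A"
    proof
      assume "p dvd card (V <#> A) div card A"
      then have pu: "p dvd u" using ux by simp
      then have "p \<in> t" using s_number_prime_dvd[OF Vt card_subgroup_pos[OF fin sV] p] uV dvd_trans by blast
      moreover have "p \<in> prime_factors (order G div card A)"
        using pu ud p \<open>u * d \<noteq> 0\<close> by (simp add: in_prime_factors_iff)
      ultimately show False using A by (auto simp: hall_sigma_subgroup_def)
    qed
  qed
  moreover have "r \<otimes> \<one> \<in> V <#> A" using rV subgroup.one_closed[OF sA] by (auto simp: set_mult_def)
  ultimately show ?thesis using rc by simp
qed

text \<open>Powers distribute over k r modulo N. The lemma bounds the order of r modulo N when the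
  order of k r is known because k r is a conjugate of k or lies in a Hall subgroup. Here
  \<open>t\<close> is an exponent, not a class.\<close>

lemma commute_mod_pow_mem:
  assumes sN: "subgroup N G" "N \<subseteq> R" and k: "k \<in> carrier G" and r: "r \<in> carrier G"
    and comm: "N #> (k \<otimes> r) = N #> (r \<otimes> k)" and kt: "k [^] (t::nat) = \<one>" and krt: "(k \<otimes> r) [^] t = \<one>"
  shows "r [^] t \<in> N"
proof -
  interpret N: normal N G by (rule normal_of_subset_R[OF sN])
  interpret Q: group "G Mod N" by (rule N.factorgroup_is_group)
  interpret h: group_hom G "G Mod N" "(#>) N" by (rule N.rcos_group_hom)
  have carr: "N #> k \<in> carrier (G Mod N)" "N #> r \<in> carrier (G Mod N)" using k r h.hom_closed by auto
  have "(N #> k) \<otimes>\<^bsub>G Mod N\<^esub> (N #> r) = (N #> r) \<otimes>\<^bsub>G Mod N\<^esub> (N #> k)"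
    using k r by (simp only: h.hom_mult[symmetric] comm)
  then have "((N #> k) \<otimes>\<^bsub>G Mod N\<^esub> (N #> r)) [^]\<^bsub>G Mod N\<^esub> t = (N #> k) [^]\<^bsub>G Mod N\<^esub> t \<otimes>\<^bsub>G Mod N\<^esub> (N #> r) [^]\<^bsub>G Mod N\<^esub> t"
    by (rule Q.pow_mult_distrib) (use carr in auto)
  moreover have "((N #> k) \<otimes>\<^bsub>G Mod N\<^esub> (N #> r)) [^]\<^bsub>G Mod N\<^esub> t = \<one>\<^bsub>G Mod N\<^esub>"
    using h.hom_mult[OF k r] N.FactGroup_pow[of "k \<otimes> r" t] k r krt N.subset by simp
  moreover have "(N #> k) [^]\<^bsub>G Mod N\<^esub> t = \<one>\<^bsub>G Mod N\<^esub>"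
    using N.FactGroup_pow[OF k, of t] kt N.subset by simp
  ultimately have "(N #> r) [^]\<^bsub>G Mod N\<^esub> t = \<one>\<^bsub>G Mod N\<^esub>"
    using carr by (metis Q.l_one Q.nat_pow_closed)
  then show ?thesis using N.FactGroup_pow[OF r, of t] N.rcos_eq_self_iff[of "r [^] t"] r by simp
qed

text \<open>It suffices to move each a in A past each y in K of prime power order. If y lies in R,
  it lies in the normal subgroup N = K \<inter> R. If the prime of y lies outside t, the conjugate a
  y a^-1 stays in y N. If it lies in t, then y itself lies in A N.\<close>

lemma hall_permutes:
  assumes K: "subgroup K G" and A: "hall_sigma_subgroup t G A" and t: "t \<in> \<Sigma>"
    and comm: "\<And>k p m r. \<lbrakk>k \<in> K; nat_prime p; \<not> p dvd card R; k [^] (p ^ m :: nat) = \<one>; r \<in> R\<rbrakk>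
      \<Longrightarrow> (K \<inter> R) #> (k \<otimes> r) = (K \<inter> R) #> (r \<otimes> k)"
  shows "K <#> A = A <#> K"
proof -
  define N where "N = K \<inter> R"
  have sA: "subgroup A G" using A by (simp add: hall_sigma_subgroup_def)
  have Ac: "\<And>a. a \<in> A \<Longrightarrow> a \<in> carrier G" using subgroup.mem_carrier[OF sA] .
  have Kc: "\<And>a. a \<in> K \<Longrightarrow> a \<in> carrier G" using subgroup.mem_carrier[OF K] .
  have sN: "subgroup N G" unfolding N_def using subgroups_Inter_pair K R_sub by blast
  have NR: "N \<subseteq> R" "N \<subseteq> K" by (auto simp: N_def)
  interpret N: normal N G by (rule normal_of_subset_R[OF sN NR(1)])
  have posA: "card A > 0" using card_subgroup_pos[OF fin sA] .
  have At: "s_number t (card A)" using A by (simp add: hall_sigma_subgroup_def)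
  have "k \<in> {y \<in> K. \<forall>a\<in>A. a \<otimes> y \<in> K <#> A}" if k: "k \<in> K" for k
  \<comment> \<open>The set of those y past which every a can be moved is closed under products,
    though not visibly under inverses.\<close>
  proof (rule primary_induct[OF fin Kc[OF k]])
    fix y z assume y: "y \<in> {y \<in> K. \<forall>a\<in>A. a \<otimes> y \<in> K <#> A}" and z: "z \<in> {y \<in> K. \<forall>a\<in>A. a \<otimes> y \<in> K <#> A}"
    have "a \<otimes> (y \<otimes> z) \<in> K <#> A" if a: "a \<in> A" for a
    proof -
      obtain k1 a1 where 1: "k1 \<in> K" "a1 \<in> A" "a \<otimes> y = k1 \<otimes> a1" using y a by (auto simp: set_mult_def)
      obtain k2 a2 where 2: "k2 \<in> K" "a2 \<in> A" "a1 \<otimes> z = k2 \<otimes> a2" using z 1 by (auto simp: set_mult_def)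
      have "a \<otimes> (y \<otimes> z) = k1 \<otimes> a1 \<otimes> z" using a y z 1(3) Ac Kc by (simp add: m_assoc[symmetric])
      also have "\<dots> = k1 \<otimes> (k2 \<otimes> a2)" using 1 2 z Ac Kc by (simp add: m_assoc)
      also have "\<dots> = k1 \<otimes> k2 \<otimes> a2" using 1 2 Ac Kc by (simp add: m_assoc)
      finally show ?thesis using 1 2 subgroup.m_closed[OF K 1(1) 2(1)] by (auto simp: set_mult_def)
    qed
    then show "y \<otimes> z \<in> {y \<in> K. \<forall>a\<in>A. a \<otimes> y \<in> K <#> A}" using y z subgroup.m_closed[OF K] by auto
  next
    fix i p m assume p: "nat_prime p" and ip: "(k [^] (i::nat)) [^] (p ^ m :: nat) = \<one>"
    define y where "y = k [^] i"
    have yK: "y \<in> K" unfolding y_def by (rule subgroup_nat_pow_closed[OF K k])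
    have yc: "y \<in> carrier G" using Kc[OF yK] .
    have yp: "y [^] (p ^ m) = \<one>" using ip by (simp add: y_def)
    have conj: "a \<otimes> y \<in> K <#> A" if a: "a \<in> A" and "a \<otimes> y \<otimes> inv a \<in> K" for a
    proof -
      have "a \<otimes> y = a \<otimes> y \<otimes> inv a \<otimes> a" using Ac[OF a] yc by (simp add: m_assoc)
      then show ?thesis using that by (auto simp: set_mult_def)
    qed
    have "a \<otimes> y \<in> K <#> A" if a: "a \<in> A" for a
    proof (cases "p dvd card R")
      case True
      then have "y \<in> N" using R_hall[OF p _ yc yp] yK by (simp add: N_def)
      then have "a \<otimes> y \<otimes> inv a \<in> N" using N.inv_op_closed2[OF Ac[OF a]] by simp
      then show ?thesis using conj[OF a] NR by auto
    next
      case False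
      obtain s where s: "s \<in> \<Sigma>" "p \<in> s" using prime_class[OF p] .
      have ppos: "p ^ m > 0" using prime_gt_0_nat[OF p] by simp
      have oneR: "\<one> \<in> R" using subgroup.one_closed[OF R_sub] .
      have sp: "s_number s (p ^ m)" using s_number_prime_power[OF p s(2)] .
      have ycomm: "N #> (y \<otimes> r) = N #> (r \<otimes> y)" if "r \<in> R" for r
        using comm[OF yK p False yp that] by (simp add: N_def)
      show ?thesis
      proof (cases "s = t")
        case False
        have ac: "a \<in> carrier G" using Ac[OF a] .
        \<comment> \<open>Read as y^-1 (a y a^-1), r is an s-element modulo R; read as (y^-1 a y)
          a^-1, it is a t-element modulo R. The classes s and t are disjoint, so r lies in
          R.\<close>
        define r where "r = inv y \<otimes> (a \<otimes> y \<otimes> inv a)"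
        have rc: "r \<in> carrier G" using ac yc by (simp add: r_def)
        have ayp: "(a \<otimes> y \<otimes> inv a) [^] (p ^ m) = \<one>" using conj_pow[OF ac yc] yp ac by simp
        have r1: "r \<in> pi_roots G s R"
        proof -
          have "y \<in> pi_roots G s R" "a \<otimes> y \<otimes> inv a \<in> pi_roots G s R"
            unfolding pi_roots_def using ppos sp yp ayp oneR yc ac by (auto intro!: exI[of _ "p ^ m"])
          then show ?thesis unfolding r_def
            using subgroup.m_closed[OF roots[OF s(1)]] subgroup.m_inv_closed[OF roots[OF s(1)]] by blast
        qed
        have r2: "r \<in> pi_roots G t R"
        proof -
          have "(inv y \<otimes> a \<otimes> y) [^] card A = \<one>"
            using conj_pow[of "inv y" a "card A"] pow_card_one[OF fin sA a] ac yc by simp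
          moreover have "(inv a) [^] card A = \<one>" using pow_card_one[OF fin sA] subgroup.m_inv_closed[OF sA a] by blast
          ultimately have "inv y \<otimes> a \<otimes> y \<in> pi_roots G t R" "inv a \<in> pi_roots G t R"
            unfolding pi_roots_def using posA At oneR ac yc by (auto intro!: exI[of _ "card A"])
          then have "inv y \<otimes> a \<otimes> y \<otimes> inv a \<in> pi_roots G t R"
            by (rule subgroup.m_closed[OF roots[OF t]])
          then show ?thesis using ac yc by (simp add: r_def m_assoc)
        qed
        obtain m1 where m1: "m1 > 0" "s_number s m1" "r [^] m1 \<in> R" using r1 by (auto simp: pi_roots_def)
        obtain m2 where m2: "m2 > 0" "s_number t m2" "r [^] m2 \<in> R" using r2 by (auto simp: pi_roots_def)
        have "coprime m1 m2"
          using s_number_prime_dvd[OF m1(2,1)] s_number_prime_dvd[OF m2(2,1)] class_disjoint[OF s(1) t False]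
          by (intro coprime_natI) auto
        then have rR: "r \<in> R" using pow_coprime_mem[OF R_sub rc m1(3) m2(3)] by blast
        have yr: "y \<otimes> r = a \<otimes> y \<otimes> inv a" using ac yc by (simp add: r_def m_assoc[symmetric])
        \<comment> \<open>y r is a conjugate of y, so both are killed by p^m; the order of r divides
          |R|, which is prime to p.\<close>
        have "r [^] (p ^ m) \<in> N"
          using commute_mod_pow_mem[OF sN NR(1) yc rc ycomm[OF rR] yp] yr ayp by simp
        moreover have "r [^] card R \<in> N" using pow_card_one[OF fin R_sub rR] N.one_closed by simp
        ultimately have "r \<in> N"
          using pow_coprime_mem[OF sN rc _ _ coprime_prime_power[OF p \<open>\<not> p dvd card R\<close>, of m]] by blast
        then have "a \<otimes> y \<otimes> inv a \<in> K" using yr[symmetric] subgroup.m_closed[OF K yK, of r] NR by auto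
        then show ?thesis using conj[OF a] by blast
      next
        case True
        have "y \<in> pi_roots G t R"
          unfolding pi_roots_def using ppos sp yp oneR yc True by (auto intro!: exI[of _ "p ^ m"])
        moreover have "carrier G <#> A = A <#> carrier G"
        proof -
          have "A <#> carrier G = carrier G"
          proof
            show "A <#> carrier G \<subseteq> carrier G" using Ac by (auto simp: set_mult_def)
            show "carrier G \<subseteq> A <#> carrier G"
            proof
              fix x assume "x \<in> carrier G"
              then have "\<one> \<otimes> x \<in> A <#> carrier G" using subgroup.one_closed[OF sA] unfolding set_mult_def by blast
              then show "x \<in> A <#> carrier G" using \<open>x \<in> carrier G\<close> by simp
            qed
          qed
          then show ?thesis using set_mult_carrier_idem[OF sA] by simp
        qed
        \<comment> \<open>\<open>hall_decomp\<close> with the whole group as H gives only y in A R;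
          it remains to replace R by N.\<close>
        ultimately obtain b r where br: "b \<in> A" "r \<in> carrier G \<inter> R" "y = b \<otimes> r"
          using hall_decomp[OF subgroup_self A _ t yc] by blast
        have rc: "r \<in> carrier G" and rR: "r \<in> R" using br by auto
        \<comment> \<open>With e and f the t-part and the t'-part of |G|, the factor r2 of order
          dividing e is absorbed into A, and only the factor r1 of order dividing f must be shown to
          lie in N.\<close>
        obtain e f where ef: "order G = e * f" "s_number t e" "s_number (- t) f" "e > 0" "f > 0"
          using s_number_split[of "order G" t] fin order_gt_0_iff_finite by blast
        have rof: "r [^] (e * f) = \<one>" using pow_order_eq_1[OF rc] ef by simp
        obtain u v where uv: "r = r [^] (e * u) \<otimes> r [^] (f * v)"
          using pow_coprime_split[OF rc rof s_number_coprime[OF ef(2-5)] ef(4,5)] .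
        define r1 where "r1 = r [^] (e * u)"
        define r2 where "r2 = r [^] (f * v)"
        have r1R: "r1 \<in> R" and r2R: "r2 \<in> R"
          unfolding r1_def r2_def using subgroup_nat_pow_closed[OF R_sub rR] by auto
        have rcs: "r1 \<in> carrier G" "r2 \<in> carrier G" using R_carrier r1R r2R by auto
        have r2e: "r2 [^] e = \<one>"
        proof -
          have "f * v * e = e * f * v" by simp
          then show ?thesis unfolding r2_def using rof rc by (metis nat_pow_one nat_pow_pow)
        qed
        have r1f: "r1 [^] f = \<one>"
        proof -
          have "e * u * f = e * f * u" by simp
          then show ?thesis unfolding r1_def using rof rc by (metis nat_pow_one nat_pow_pow)
        qed
        have r2A: "r2 \<in> A" using pi_element_of_R_in_hall[OF A r2R r2e ef(2,4)] .
        have "r = r2 \<otimes> r1" using uv nat_pow_comm[OF rc] by (metis r1_def r2_def)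
        then have ybr: "y = (b \<otimes> r2) \<otimes> r1" using br(3) rcs Ac[OF br(1)] by (simp add: m_assoc)
        have bA: "b \<otimes> r2 \<in> A" using subgroup.m_closed[OF sA br(1) r2A] .
        \<comment> \<open>Both y and y r1^-1 = b r2 are killed by the t-number p^m |A|, so r1^-1 is
          a t-element modulo N; but r1 is killed by f.\<close>
        have "r1 \<in> N"
        proof -
          have y1: "y \<otimes> inv r1 = b \<otimes> r2" using ybr rcs Ac[OF bA] by (simp add: m_assoc)
          have yM: "y [^] (p ^ m * card A) = \<one>" using yp yc by (simp flip: nat_pow_pow)
          have "(y \<otimes> inv r1) [^] (p ^ m * card A) = \<one>"
            unfolding y1 using pow_card_one[OF fin sA bA] Ac[OF bA]
            by (metis mult.commute nat_pow_one nat_pow_pow)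
          then have "(inv r1) [^] (p ^ m * card A) \<in> N"
            using commute_mod_pow_mem[OF sN NR(1) yc _ ycomm yM] subgroup.m_inv_closed[OF R_sub r1R] rcs by auto
          moreover have "(inv r1) [^] f \<in> N" using nat_pow_inv[OF rcs(1)] r1f N.one_closed by simp
          moreover have "coprime (p ^ m * card A) f"
            using s_number_coprime[of t "p ^ m * card A" f] s_number_mult[of t "p ^ m" "card A"] sp True At ef ppos posA by simp
          ultimately have "inv r1 \<in> N" using pow_coprime_mem[OF sN] rcs by blast
          then show ?thesis using N.m_inv_closed rcs by (metis inv_inv)
        qed
        have "a \<otimes> (b \<otimes> r2) \<in> A" using subgroup.m_closed[OF sA a bA] .
        moreover have "a \<otimes> y = a \<otimes> (b \<otimes> r2) \<otimes> r1" using ybr Ac[OF a] Ac[OF bA] rcs by (simp add: m_assoc)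
        ultimately have "a \<otimes> y \<in> A <#> N" using \<open>r1 \<in> N\<close> by (auto simp: set_mult_def)
        then have "a \<otimes> y \<in> N <#> A" using commut_normal[OF sA N.normal_axioms] by simp
        then show ?thesis using NR by (auto simp: set_mult_def)
      qed
    qed
    then show "k [^] i \<in> {y \<in> K. \<forall>a\<in>A. a \<otimes> y \<in> K <#> A}" using yK by (simp add: y_def)
  qed
  then have "A <#> K \<subseteq> K <#> A" by (auto simp: set_mult_def[of _ A K])
  then show ?thesis by (rule set_mult_commuteI[OF sA K])
qed

text \<open>\<open>hall_permutes\<close> holds for every Hall subgroup of a class, so the Hall
  \<sigma>-set that witnesses quasinormality of H serves for K as well.\<close>

theorem PsT_group: "PsT_group \<Sigma> G"
  unfolding PsT_group_def
proof (intro allI impI)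
  fix H K assume H: "sigma_quasinormal \<Sigma> G H" and K: "sigma_quasinormal \<Sigma> (G\<lparr>carrier := H\<rparr>) K"
  have sH: "subgroup H G" using H by (simp add: sigma_quasinormal_def)
  have sK: "subgroup K G" using incl_subgroup[OF sH] K by (simp add: sigma_quasinormal_def)
  obtain \<H> where \<H>: "complete_hall_sigma_set \<Sigma> G \<H>"
    using H unfolding sigma_quasinormal_def by (elim conjE exE) (rule that)
  have "K <#> ((inv x <# A) #> x) = ((inv x <# A) #> x) <#> K" if A: "A \<in> \<H>" and x: "x \<in> carrier G" for A x
  \<comment> \<open>A complete Hall \<sigma>-set may contain the trivial subgroup, for which the
    definition provides no class.\<close>
  proof (cases "A = {\<one>}")
    case True
    then have "(inv x <# A) #> x = {\<one>}" using x by (auto simp: l_coset_def r_coset_def)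
    then show ?thesis using subgroup.mem_carrier[OF sK] by (auto simp: set_mult_def)
  next
    case False
    then obtain t where t: "t \<in> \<Sigma>" "hall_sigma_subgroup t G A"
      using \<H> A unfolding complete_hall_sigma_set_def by (metis (no_types, lifting))
    show ?thesis
      using hall_permutes[OF sK hall_sigma_subgroup_conj[OF t(2) x] t(1) quasinormal_trans_commute[OF H K]] .
  qed
  then show "sigma_quasinormal \<Sigma> G K"
    unfolding sigma_quasinormal_def using sK \<H> by (intro conjI exI[of _ \<H>]) auto
qed

end

section \<open>\<sigma>-nilpotent groups\<close>

lemma (in normal) pow_mult_mem_iff:
  assumes "n \<in> H" "g \<in> carrier G"
  shows "(n \<otimes> g) [^] (m::nat) \<in> H \<longleftrightarrow> g [^] m \<in> H"
proof -
  have nc: "n \<in> carrier G" using assms mem_carrier by blast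
  have "H #> (n \<otimes> g) = H #> g"
    using coset_mult_assoc[OF subset nc assms(2)] rcos_eq_self_iff[OF nc] assms by simp
  then have "H #> (n \<otimes> g) [^] m = H #> g [^] m"
    using FactGroup_pow[of "n \<otimes> g" m] FactGroup_pow[of g m] assms nc by simp
  then show ?thesis
    using rcos_eq_self_iff[of "(n \<otimes> g) [^] m"] rcos_eq_self_iff[of "g [^] m"] assms nc by simp
qed

lemma (in group_hom) subgroup_preimage:
  assumes V: "subgroup V H"
  shows "subgroup {x \<in> carrier G. h x \<in> V} G"
  using subgroup.m_closed[OF V] subgroup.m_inv_closed[OF V] subgroup.one_closed[OF V]
  by (intro subgroup.intro) auto

lemma (in group_hom) pi_roots_preimage:
  "pi_roots G t {x \<in> carrier G. h x \<in> V} = {x \<in> carrier G. h x \<in> pi_roots H t V}"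
  by (auto simp: pi_roots_def hom_nat_pow)

lemma sigma_primary_cases:
  assumes part: "partition_on primes_set \<Sigma>"
    and prim: "sigma_primary \<Sigma> (G\<lparr>carrier := H\<rparr>)" and s: "s \<in> \<Sigma>" and no: "\<not> s_number s (card H)"
  shows "s_number (- s) (card H)"
proof (rule ccontr)
  assume "\<not> s_number (- s) (card H)"
  then obtain p where p: "p \<in> prime_factors (card H)" "p \<in> s" by (auto simp: s_number_def)
  obtain q where q: "q \<in> prime_factors (card H)" "q \<notin> s" using no by (auto simp: s_number_def)
  obtain t where t: "t \<in> \<Sigma>" "q \<in> t"
    using partition_onD1[OF part] in_prime_factors_imp_prime[OF q(1)] by (auto simp: primes_set_def)
  let ?S = "{u \<in> \<Sigma>. u \<inter> prime_factors (card H) \<noteq> {}}"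
  \<comment> \<open>An infinite set has \<open>card\<close> 0, so finiteness must be secured before
    the bound on \<open>card\<close> can be used. A class is recovered from any prime in it.\<close>
  have "?S \<subseteq> (\<lambda>p. THE u. u \<in> \<Sigma> \<and> p \<in> u) ` prime_factors (card H)"
  proof
    fix u assume "u \<in> ?S"
    then obtain x where x: "x \<in> u" "x \<in> prime_factors (card H)" "u \<in> \<Sigma>" by auto
    have "(THE u. u \<in> \<Sigma> \<and> x \<in> u) = u"
      using x partition_onD2[OF part] by (intro the_equality) (auto simp: disjoint_def)
    then show "u \<in> (\<lambda>p. THE u. u \<in> \<Sigma> \<and> p \<in> u) ` prime_factors (card H)" using x by blast
  qed
  then have "finite ?S" by (rule finite_subset) simp
  moreover have "{s, t} \<subseteq> ?S" using s t p q by auto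
  ultimately have "card {s, t} \<le> card ?S" by (rule card_mono)
  moreover have "s \<noteq> t" using q t by blast
  then have "card {s, t} = 2" by simp
  ultimately show False using prim by (simp add: sigma_primary_def sigma_of_group_def sigma_of_nat_def order_def)
qed

section \<open>Roots modulo normal subgroups, and products of normal s-subgroups\<close>

context group
begin

text \<open>The t-part e of |G| works for all N at once: if x^m lies in N for a t-number m, so does
  the power of x with exponent gcd(m, |G|), and this gcd divides e. A uniform exponent makes
  \<open>pi_roots\<close> commute with intersections.\<close>

lemma pi_roots_uniform:
  assumes fin: "finite (carrier G)"
  obtains e where "\<And>N x. subgroup N G \<Longrightarrow> x \<in> carrier G \<Longrightarrow> x \<in> pi_roots G t N \<longleftrightarrow> x [^] (e::nat) \<in> N"
proof -
  obtain e f where ef: "order G = e * f" "s_number t e" "s_number (- t) f" "e > 0" "f > 0"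
    using s_number_split[of "order G" t] fin order_gt_0_iff_finite by blast
  show ?thesis
  proof
    fix N x assume N: "subgroup N G" and x: "x \<in> carrier G"
    show "x \<in> pi_roots G t N \<longleftrightarrow> x [^] e \<in> N"
    proof
      assume "x \<in> pi_roots G t N"
      then obtain m where m: "m > 0" "s_number t m" "x [^] m \<in> N" by (auto simp: pi_roots_def)
      have "x [^] (e * f) \<in> N" using pow_order_eq_1[OF x] ef subgroup.one_closed[OF N] by simp
      then have *: "x [^] gcd m (e * f) \<in> N" using pow_gcd_mem[OF N x m(3)] by blast
      have "coprime m f" using s_number_coprime[OF m(2) ef(3) m(1) ef(5)] .
      then have "gcd m (e * f) dvd e"
        by (metis coprime_dvd_mult_left_iff coprime_divisors gcd_dvd1 gcd_dvd2 dvd_refl)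
      then obtain j where "e = gcd m (e * f) * j" by (elim dvdE)
      then show "x [^] e \<in> N" using subgroup_nat_pow_closed[OF N *, of j] x by (simp add: nat_pow_pow)
    qed (use ef x in \<open>auto simp: pi_roots_def\<close>)
  qed
qed

text \<open>Carries the usable content of \<sigma>-nilpotence from the quotients by members of F to
  the quotient by their intersection; applied to the residual and to the final R.\<close>

lemma pi_roots_Inter_subgroup:
  assumes fin: "finite (carrier G)"
    and F: "\<And>N. N \<in> F \<Longrightarrow> subgroup N G" "\<And>N. N \<in> F \<Longrightarrow> subgroup (pi_roots G t N) G"
  shows "subgroup (pi_roots G t (\<Inter>F)) G"
proof (cases "F = {}")
  case True
  \<comment> \<open>The empty intersection is \<open>UNIV\<close>.\<close>
  have "pi_roots G t UNIV = carrier G" by (auto simp: pi_roots_def s_number_def intro: exI[of _ 1])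
  then show ?thesis using True subgroup_self by simp
next
  case False
  obtain e where e: "\<And>N x. subgroup N G \<Longrightarrow> x \<in> carrier G \<Longrightarrow> x \<in> pi_roots G t N \<longleftrightarrow> x [^] (e::nat) \<in> N"
    using pi_roots_uniform[OF fin] by blast
  have I: "subgroup (\<Inter>F) G" using subgroups_Inter False F by blast
  have c: "\<And>N x. x \<in> pi_roots G t N \<Longrightarrow> x \<in> carrier G" by (auto simp: pi_roots_def)
  have "pi_roots G t (\<Inter>F) = \<Inter>(pi_roots G t ` F)"
  proof (rule Set.set_eqI)
    fix x
    show "x \<in> pi_roots G t (\<Inter>F) \<longleftrightarrow> x \<in> \<Inter>(pi_roots G t ` F)"
    proof (cases "x \<in> carrier G")
      case True
      then show ?thesis using e[OF I True] e[OF F(1) True] by auto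
    next
      case no: False
      then show ?thesis using c False by blast
    qed
  qed
  then show ?thesis using subgroups_Inter[of "pi_roots G t ` F"] False F by auto
qed

lemma generate_normal_family:
  assumes "\<And>H. H \<in> F \<Longrightarrow> H \<lhd> G"
  shows "generate G (\<Union>F) \<lhd> G"
proof (rule normal_generateI)
  show "\<Union>F \<subseteq> carrier G" using assms normal_imp_subgroup subgroup.subset by blast
  show "\<And>h g. h \<in> \<Union>F \<Longrightarrow> g \<in> carrier G \<Longrightarrow> g \<otimes> h \<otimes> inv g \<in> \<Union>F"
    by (meson UnionE UnionI assms normal.inv_op_closed2)
qed

text \<open>If x = y v with y in the new member H and v^m = 1, then x^m falls into H, so x^(m n) = 1
  for some s-number n.\<close>

lemma normal_family_pi_roots:
  assumes "finite F" "\<And>H. H \<in> F \<Longrightarrow> H \<lhd> G \<and> H \<subseteq> pi_roots G s {\<one>}"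
  shows "generate G (\<Union>F) \<subseteq> pi_roots G s {\<one>}"
  using assms
proof (induction F rule: finite_induct)
  case empty
  show ?case by (auto simp: generate_empty pi_roots_def s_number_def intro!: exI[of _ 1])
next
  case (insert H F)
  define V where "V = generate G (\<Union>F)"
  have V: "V \<lhd> G" unfolding V_def using generate_normal_family insert.prems by blast
  have sV: "subgroup V G" using V by (rule normal_imp_subgroup)
  interpret H: normal H G using insert.prems by blast
  have sub: "\<Union>(insert H F) \<subseteq> H <#> V"
  proof
    fix x assume "x \<in> \<Union>(insert H F)"
    then have "x \<in> H \<or> x \<in> V" using generate.incl[of x "\<Union>F" G] by (auto simp: V_def)
    then show "x \<in> H <#> V"
    proof
      assume "x \<in> H"
      then have "x \<otimes> \<one> \<in> H <#> V" using subgroup.one_closed[OF sV] unfolding set_mult_def by blast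
      then show ?thesis using \<open>x \<in> H\<close> by simp
    next
      assume "x \<in> V"
      then have "\<one> \<otimes> x \<in> H <#> V" using H.one_closed unfolding set_mult_def by blast
      then show ?thesis using \<open>x \<in> V\<close> subgroup.mem_carrier[OF sV] by simp
    qed
  qed
  have "generate G (\<Union>(insert H F)) \<subseteq> H <#> V"
    by (rule generate_subgroup_incl[OF sub mult_norm_subgroup[OF H.normal_axioms sV]])
  moreover have "H <#> V \<subseteq> pi_roots G s {\<one>}"
  proof
    fix x assume "x \<in> H <#> V"
    then obtain y v where yv: "y \<in> H" "v \<in> V" "x = y \<otimes> v" by (auto simp: set_mult_def)
    have c: "y \<in> carrier G" "v \<in> carrier G" using yv H.mem_carrier subgroup.mem_carrier[OF sV] by auto
    have "v \<in> pi_roots G s {\<one>}" using insert yv(2) unfolding V_def by blast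
    then obtain m where m: "m > 0" "s_number s m" "v [^] m = \<one>" by (auto simp: pi_roots_def)
    have "x [^] m \<in> H" using H.pow_mult_mem_iff[OF yv(1) c(2)] yv m H.one_closed by simp
    then have "x [^] m \<in> pi_roots G s {\<one>}" using insert.prems by blast
    then obtain n where n: "n > 0" "s_number s n" "(x [^] m) [^] n = \<one>" by (auto simp: pi_roots_def)
    then have "x [^] (m * n) = \<one>" "m * n > 0" "s_number s (m * n)" "x \<in> carrier G"
      using m s_number_mult c yv by (auto simp: nat_pow_pow)
    then show "x \<in> pi_roots G s {\<one>}" unfolding pi_roots_def by blast
  qed
  ultimately show ?case by blast
qed

text \<open>If a b has s-number order, then b is an s-element modulo A; it is also an s'-element, so
  b lies in A.\<close>

lemma pi_roots_of_factorization:
  assumes A: "A \<lhd> G" "A \<subseteq> pi_roots G s {\<one>}" and B: "subgroup B G" "B \<subseteq> pi_roots G (- s) {\<one>}"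
    and AB: "carrier G \<subseteq> A <#> B"
  shows "pi_roots G s {\<one>} = A"
proof
  interpret A: normal A G by (rule A)
  show "pi_roots G s {\<one>} \<subseteq> A"
  proof
    fix x assume x: "x \<in> pi_roots G s {\<one>}"
    then obtain m where m: "m > 0" "s_number s m" "x [^] m = \<one>" by (auto simp: pi_roots_def)
    have "x \<in> carrier G" using x by (auto simp: pi_roots_def)
    then obtain a b where ab: "a \<in> A" "b \<in> B" "x = a \<otimes> b" using AB by (auto simp: set_mult_def)
    obtain n where n: "n > 0" "s_number (- s) n" "b [^] n = \<one>" using ab B(2) by (auto simp: pi_roots_def)
    have bc: "b \<in> carrier G" using subgroup.mem_carrier[OF B(1) ab(2)] .
    have "b [^] m \<in> A" using A.pow_mult_mem_iff[OF ab(1) bc, of m] ab(3) m A.one_closed by simp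
    moreover have "b [^] n \<in> A" using n A.one_closed by simp
    ultimately have "b \<in> A" using pow_coprime_mem[OF A.is_subgroup bc] s_number_coprime[OF m(2) n(2) m(1) n(1)] by blast
    then show "x \<in> A" using ab by simp
  qed
qed (rule A)

lemma s_number_card_subset_pi_roots:
  assumes "finite (carrier G)" "subgroup H G" "s_number s (card H)"
  shows "H \<subseteq> pi_roots G s {\<one>}"
  using pow_card_one[OF assms(1,2)] card_subgroup_pos[OF assms(1,2)] subgroup.mem_carrier[OF assms(2)] assms(3)
  by (auto simp: pi_roots_def)

text \<open>The primary factors are sorted into the s-groups and the rest, which are s'-groups by
  \<open>sigma_primary_cases\<close>; the products A and B of the two sorts factorize G. The first
  claim feeds \<open>roots\<close>; the second will describe O^s(D).\<close>

lemma sigma_nilpotent_pi_roots: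
  assumes fin: "finite (carrier G)" and part: "partition_on primes_set \<Sigma>"
    and nil: "sigma_nilpotent \<Sigma> G" and s: "s \<in> \<Sigma>"
  shows "subgroup (pi_roots G s {\<one>}) G" "subgroup (pi_roots G (- s) {\<one>}) G"
proof -
  obtain F where F: "finite F" "\<And>H. H \<in> F \<Longrightarrow> H \<lhd> G" "\<And>H. H \<in> F \<Longrightarrow> sigma_primary \<Sigma> (G\<lparr>carrier := H\<rparr>)"
    "generate G (\<Union>F) = carrier G"
    using nil unfolding sigma_nilpotent_def by (elim exE conjE) (rule that, auto)
  define FA where "FA = {H \<in> F. s_number s (card H)}"
  define FB where "FB = {H \<in> F. \<not> s_number s (card H)}"
  define A where "A = generate G (\<Union>FA)"
  define B where "B = generate G (\<Union>FB)"
  have A: "A \<lhd> G" unfolding A_def using F(2) by (intro generate_normal_family) (auto simp: FA_def)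
  have B: "B \<lhd> G" unfolding B_def using F(2) by (intro generate_normal_family) (auto simp: FB_def)
  have sA: "subgroup A G" and sB: "subgroup B G" using A B normal_imp_subgroup by auto
  have Ar: "A \<subseteq> pi_roots G s {\<one>}" unfolding A_def
    using F(1,2) s_number_card_subset_pi_roots[OF fin normal_imp_subgroup]
    by (intro normal_family_pi_roots) (auto simp: FA_def)
  have Br: "B \<subseteq> pi_roots G (- s) {\<one>}" unfolding B_def
    using F(1,2) s_number_card_subset_pi_roots[OF fin normal_imp_subgroup] sigma_primary_cases[OF part F(3) s]
    by (intro normal_family_pi_roots) (auto simp: FB_def)
  have "\<Union>F \<subseteq> A <#> B"
  proof
    fix x assume x: "x \<in> \<Union>F"
    then have xc: "x \<in> carrier G" by (meson UnionE F(2) normal_imp_subgroup subgroup.mem_carrier)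
    have "x \<in> A \<or> x \<in> B" using x unfolding A_def B_def FA_def FB_def by (auto intro: generate.incl)
    then have "x \<otimes> \<one> \<in> A <#> B \<or> \<one> \<otimes> x \<in> A <#> B"
      using subgroup.one_closed[OF sA] subgroup.one_closed[OF sB] unfolding set_mult_def by blast
    then show "x \<in> A <#> B" using xc by simp
  qed
  then have AB: "carrier G \<subseteq> A <#> B"
    using generate_subgroup_incl[OF _ mult_norm_subgroup[OF A sB], of "\<Union>F"] F(4) by simp
  then have BA: "carrier G \<subseteq> B <#> A" using commut_normal[OF sA B] by simp
  show "subgroup (pi_roots G s {\<one>}) G"
    using pi_roots_of_factorization[OF A Ar sB Br AB] sA by simp
  show "subgroup (pi_roots G (- s) {\<one>}) G"
    using pi_roots_of_factorization[OF B Br sA _ BA] Ar sB by simp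
qed

lemma FactGroup_finite: "finite (carrier G) \<Longrightarrow> finite (carrier (G Mod N))"
  by (simp add: carrier_FactGroup)

lemma sigma_nilpotent_Mod_pi_roots:
  assumes fin: "finite (carrier G)" and part: "partition_on primes_set \<Sigma>"
    and N: "N \<lhd> G" and nil: "sigma_nilpotent \<Sigma> (G Mod N)" and s: "s \<in> \<Sigma>"
  shows "subgroup (pi_roots G s N) G"
proof -
  interpret N: normal N G by (rule N)
  interpret h: group_hom G "G Mod N" "(#>) N" by (rule N.rcos_group_hom)
  have "N = {x \<in> carrier G. N #> x \<in> {\<one>\<^bsub>G Mod N\<^esub>}}" using N.rcos_eq_self_iff N.mem_carrier
    unfolding one_FactGroup singleton_iff by blast
  then have "pi_roots G s N = {x \<in> carrier G. N #> x \<in> pi_roots (G Mod N) s {\<one>\<^bsub>G Mod N\<^esub>}}"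
    using h.pi_roots_preimage[of s "{\<one>\<^bsub>G Mod N\<^esub>}"] by simp
  then show ?thesis
    using h.subgroup_preimage[OF h.H.sigma_nilpotent_pi_roots(1)[OF FactGroup_finite[OF fin] part nil s]] by simp
qed

end

section \<open>Special groups and the theorem\<close>

context group
begin

lemma commute_of_commutator_one:
  assumes "a \<in> carrier G" "b \<in> carrier G" "a \<otimes> b \<otimes> inv a \<otimes> inv b = \<one>"
  shows "a \<otimes> b = b \<otimes> a"
proof -
  have "a \<otimes> b \<otimes> inv a = b" using assms by (metis inv_closed inv_equality inv_inv m_closed)
  then show ?thesis using assms by (metis inv_closed inv_solve_right' m_closed)
qed

text \<open>The residual C plays the role of R. As an intersection of kernels of \<sigma>-nilpotent
  quotients it satisfies \<open>roots\<close>, and the complement S supplies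
  \<open>primary_commute\<close> for elements k outside C.\<close>

lemma special_PsT_power_hall:
  assumes fin: "finite (carrier G)" and part: "partition_on primes_set \<Sigma>" and sp: "special_PsT \<Sigma> G"
  shows "power_hall G \<Sigma> (sigma_nilpotent_residual \<Sigma> G)"
proof -
  define C where "C = sigma_nilpotent_residual \<Sigma> G"
  obtain s E S where s: "s \<in> \<Sigma>" and E: "hall_sigma_subgroup s G E" "C \<subseteq> E"
    and hall: "hall_subgroup G C" and pow: "induces_power_auts G C"
    and S: "S \<lhd> G\<lparr>carrier := E\<rparr>" "C <#> S = E" "C \<inter> S = {\<one>}"
    using sp unfolding special_PsT_def Let_def C_def[symmetric] by blast
  have sC: "subgroup C G" and cop: "coprime (card C) (order G div card C)"
    using hall by (auto simp: hall_subgroup_def)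
  have Cc: "\<And>x. x \<in> C \<Longrightarrow> x \<in> carrier G" using subgroup.mem_carrier[OF sC] .
  have sE: "subgroup E G" using E by (simp add: hall_sigma_subgroup_def)
  have Ec: "\<And>x. x \<in> E \<Longrightarrow> x \<in> carrier G" using subgroup.mem_carrier[OF sE] .
  have conj_pow: "\<exists>n::nat. inv g \<otimes> x \<otimes> g = x [^] n" if x: "x \<in> C" and g: "g \<in> carrier G" for x g
  proof -
    \<comment> \<open>A power automorphism maps the cyclic group generated by x onto itself, so x
      goes to a power of x.\<close>
    have "subgroup (generate G {x}) (G\<lparr>carrier := C\<rparr>)"
      using x Cc generate_is_subgroup[of "{x}"] generate_subgroup_incl[OF _ sC, of "{x}"]
      by (intro subgroup_incl[OF _ sC]) auto
    then have "(\<lambda>h. inv g \<otimes> h \<otimes> g) ` generate G {x} = generate G {x}"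
      using pow g unfolding induces_power_auts_def by blast
    moreover have "x \<in> generate G {x}" by (simp add: generate.incl)
    ultimately have "inv g \<otimes> x \<otimes> g \<in> generate G {x}" by blast
    then show ?thesis using generate_pow_on_finite_carrier[OF fin Cc[OF x]] by auto
  qed
  have Cn: "C \<lhd> G"
  proof (rule normal_invI[OF sC])
    fix g x assume g: "g \<in> carrier G" and x: "x \<in> C"
    obtain n where "inv (inv g) \<otimes> x \<otimes> inv g = x [^] (n::nat)" using conj_pow[OF x, of "inv g"] g by auto
    then show "g \<otimes> x \<otimes> inv g \<in> C" using g subgroup_nat_pow_closed[OF sC x] by simp
  qed
  interpret C: normal C G by (rule Cn)
  have C_hall: "x \<in> C" if p: "nat_prime p" "p dvd card C" and x: "x \<in> carrier G" "x [^] (p ^ n :: nat) = \<one>" for p x n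
  proof (rule pow_one_normal_mem[OF fin Cn x])
    have "\<not> p dvd order G div card C"
      using cop p by (metis coprime_common_divisor_nat not_prime_1)
    then show "coprime (p ^ n) (order G div card C)" by (rule coprime_prime_power[OF p(1)])
  qed
  have roots: "subgroup (pi_roots G t C) G" if t: "t \<in> \<Sigma>" for t
    unfolding C_def sigma_nilpotent_residual_def
    by (rule pi_roots_Inter_subgroup[OF fin])
      (auto intro: normal_imp_subgroup sigma_nilpotent_Mod_pi_roots[OF fin part _ _ t])
  have comm: "k \<otimes> r = r \<otimes> k"
    if t: "t \<in> \<Sigma>" and pq: "nat_prime p" "nat_prime q" "p \<in> t" "q \<in> t" "p \<noteq> q"
      and k: "k \<in> carrier G" "k [^] (p ^ m :: nat) = \<one>" and r: "r \<in> C" "r [^] (q ^ n :: nat) = \<one>" for t p q k m r n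
  proof (cases "r = \<one>")
    case True
    then show ?thesis using k by simp
  next
    case False
    have rc: "r \<in> carrier G" using Cc[OF r(1)] .
    let ?c = "k \<otimes> r \<otimes> inv k \<otimes> inv r"
    have cc: "?c \<in> carrier G" using k rc by simp
    have "?c = \<one>"
    proof (cases "p dvd card C")
      case True
      \<comment> \<open>Both cyclic groups, of r and of k, are now invariant, so the commutator lies
        in both and its order divides the coprime numbers q^n and p^m.\<close>
      then have kC: "k \<in> C" using C_hall[OF pq(1) _ k] by blast
      have self: "inv y \<in> generate G {y}" "y \<in> generate G {y}" for y
        by (simp_all add: generate.incl generate.inv)
      obtain i where i: "inv (inv k) \<otimes> r \<otimes> inv k = r [^] (i::nat)" using conj_pow[OF r(1), of "inv k"] k by auto
      obtain j where j: "inv (inv r) \<otimes> inv k \<otimes> inv r = (inv k) [^] (j::nat)"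
        using conj_pow[of "inv k" "inv r"] kC subgroup.m_inv_closed[OF sC] rc by auto
      have sr: "subgroup (generate G {r}) G" and sk: "subgroup (generate G {k}) G"
        using generate_is_subgroup rc k by auto
      have "?c = r [^] i \<otimes> inv r" using i k by simp
      then have cr: "?c \<in> generate G {r}"
        using self subgroup.m_closed[OF sr] subgroup_nat_pow_closed[OF sr] by metis
      have "?c = k \<otimes> (inv k) [^] j" using j[symmetric] k rc by (simp add: m_assoc)
      then have ck: "?c \<in> generate G {k}"
        using self subgroup.m_closed[OF sk] subgroup_nat_pow_closed[OF sk] by metis
      have "?c [^] (q ^ n) = \<one>"
      proof -
        obtain u where "?c = r [^] (u::nat)" using cr generate_pow_on_finite_carrier[OF fin rc] by auto
        then show ?thesis using r rc by (metis mult.commute nat_pow_one nat_pow_pow)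
      qed
      moreover have "?c [^] (p ^ m) = \<one>"
      proof -
        obtain u where "?c = k [^] (u::nat)" using ck generate_pow_on_finite_carrier[OF fin k(1)] by auto
        then show ?thesis using k by (metis mult.commute nat_pow_one nat_pow_pow)
      qed
      moreover have "coprime (q ^ n) (p ^ m)" using pq by (simp add: primes_coprime)
      ultimately show ?thesis using pow_coprime_one[OF cc] by blast
    next
      case False
      have Et: "s_number s (card E)" using E by (simp add: hall_sigma_subgroup_def)
      have "q dvd card E" using prime_dvd_card_subgroup[OF fin sE _ \<open>r \<noteq> \<one>\<close> pq(2) r(2)] r(1) E(2) by blast
      then have "q \<in> s" using s_number_prime_dvd[OF Et card_subgroup_pos[OF fin sE] pq(2)] by blast
      then have st: "s = t" using t s pq(4) partition_onD2[OF part] unfolding disjoint_def by blast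
      \<comment> \<open>V contains all t-elements of G. Since C lies in the t-group E, comparing
        indices prime by prime gives E = V, so E contains k.\<close>
      define V where "V = pi_roots G t C"
      have sV: "subgroup V G" unfolding V_def by (rule roots[OF t])
      have EV: "E \<subseteq> V"
      proof
        fix x assume x: "x \<in> E"
        then show "x \<in> V" unfolding V_def pi_roots_def
          using Et st pow_card_one[OF fin sE x] card_subgroup_pos[OF fin sE] Ec[OF x] C.one_closed
          by (auto intro!: exI[of _ "card E"])
      qed
      have "E = V"
      proof (rule subgroup_eq_of_index[OF fin sV sE EV])
        fix l assume l: "nat_prime l"
        show "\<not> l dvd card V div card E"
        proof (cases "l \<in> t")
          case True
          obtain u where u: "card V = card E * u" using card_subgroup_mono_dvd[OF fin sE sV EV] by auto
          obtain d where d: "order G = card V * d" using card_subgroup_dvd[OF fin sV] by auto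
          have ud: "order G div card E = u * d" "card V div card E = u"
            using u d card_subgroup_pos[OF fin sE] by auto
          have nz: "u * d \<noteq> 0" using d u fin order_gt_0_iff_finite by fastforce
          show ?thesis
          proof
            assume "l dvd card V div card E"
            then have "l \<in> prime_factors (order G div card E)"
              using ud nz l by (simp add: in_prime_factors_iff)
            then show False using True E st by (auto simp: hall_sigma_subgroup_def)
          qed
        next
          case False
          show ?thesis
          proof (rule not_prime_dvd_index[OF fin sV sE EV l])
            fix x n assume x: "x \<in> V" "x [^] (l ^ n :: nat) = \<one>"
            then obtain w where w: "w > 0" "s_number t w" "x [^] w \<in> C" "x \<in> carrier G" by (auto simp: V_def pi_roots_def)
            have "\<not> l dvd w" using s_number_prime_dvd[OF w(2,1) l] False by blast
            then have "x \<in> C"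
              using pow_coprime_mem[OF sC w(4) _ w(3) coprime_prime_power[OF l, of w n]] x C.one_closed by simp
            then show "x \<in> E" using E by blast
          qed
        qed
      qed
      moreover have "k \<in> V"
        unfolding V_def pi_roots_def
        using k s_number_prime_power[OF pq(1,3)] prime_gt_0_nat[OF pq(1)] C.one_closed
        by (auto intro!: exI[of _ "p ^ m"])
      ultimately have kE: "k \<in> E" by simp
      interpret E: group "G\<lparr>carrier := E\<rparr>" by (rule subgroup_imp_group[OF sE])
      interpret S: normal S "G\<lparr>carrier := E\<rparr>" by (rule S)
      have sS: "subgroup S G" using incl_subgroup[OF sE S.is_subgroup] .
      \<comment> \<open>From k = u d with u in S and d in C, k^|C| lies in S; the order of k is
        prime to |C|, so k lies in S. The commutator of k and r then lies in S \<inter> C.\<close>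
      have "k \<in> S <#> C"
        using kE S(2) commut_normal_subgroup[OF sE S(1) subgroup_incl[OF sC sE E(2)]] by simp
      then obtain u d where ud: "u \<in> S" "d \<in> C" "k = u \<otimes> d" by (auto simp: set_mult_def)
      have "d [^] card C \<in> S" using pow_card_one[OF fin sC ud(2)] subgroup.one_closed[OF sS] by simp
      then have "k [^] card C \<in> S"
        using S.pow_mult_mem_iff[OF ud(1), of d "card C"] ud E(2) by (auto simp: nat_pow_consistent[symmetric])
      then have kS: "k \<in> S"
        using pow_coprime_mem[OF sS k(1) _ _ coprime_prime_power[OF pq(1) False, of m]] k subgroup.one_closed[OF sS] by simp
      have rE: "r \<in> E" using r E by blast
      have "k \<otimes> r \<otimes> inv k \<in> C" using C.inv_op_closed2[OF k(1) r(1)] .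
      then have "?c \<in> C" using C.m_closed C.m_inv_closed r(1) by blast
      moreover have "r \<otimes> inv k \<otimes> inv r \<in> S"
        using S.inv_op_closed2[of r "inv k"] rE subgroup.m_inv_closed[OF sS kS] m_inv_consistent[OF sE rE] by simp
      then have "k \<otimes> (r \<otimes> inv k \<otimes> inv r) \<in> S" using subgroup.m_closed[OF sS kS] by blast
      then have "?c \<in> S" using k rc by (simp add: m_assoc)
      ultimately show ?thesis using S(3) by blast
    qed
    then show ?thesis using commute_of_commutator_one[OF k(1) rc] by blast
  qed
  show ?thesis
    unfolding C_def[symmetric]
    by (intro power_hall.intro power_hall_axioms.intro group_axioms part fin Cn)
      (fact C_hall conj_pow roots comm)+
qed

end

text \<open>Elements of s'-number order lie in every normal N of s-number index. Conversely, the
  subgroup they form contains all p-elements of D for p outside s, so its own index is an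
  s-number.\<close>

lemma (in group) O_sigma_eq:
  assumes fin: "finite (carrier G)" and D: "subgroup D G"
    and sub: "subgroup (pi_roots G (- s) {\<one>} \<inter> D) G"
  shows "O_sigma s G D = pi_roots G (- s) {\<one>} \<inter> D"
proof
  interpret D: group "G\<lparr>carrier := D\<rparr>" by (rule subgroup_imp_group[OF D])
  define M where "M = pi_roots G (- s) {\<one>} \<inter> D"
  have Dc: "\<And>x. x \<in> D \<Longrightarrow> x \<in> carrier G" using subgroup.mem_carrier[OF D] .
  have finD: "finite (carrier (G\<lparr>carrier := D\<rparr>))" using fin subgroup.subset[OF D] finite_subset by auto
  have sM: "subgroup M G" "M \<subseteq> D" using sub by (auto simp: M_def)
  have "M \<lhd> G\<lparr>carrier := D\<rparr>"
  proof (rule D.normal_invI[OF subgroup_incl[OF sM(1) D sM(2)]])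
    fix g x assume g: "g \<in> carrier (G\<lparr>carrier := D\<rparr>)" and x: "x \<in> M"
    then obtain m where "m > 0" "s_number (- s) m" "x [^] m = \<one>" by (auto simp: M_def pi_roots_def)
    moreover have "(g \<otimes> x \<otimes> inv g) [^] m = g \<otimes> x [^] m \<otimes> inv g" using conj_pow g x sM Dc by auto
    ultimately have "g \<otimes> x \<otimes> inv g \<in> M"
      unfolding M_def pi_roots_def using g x sM Dc subgroup.m_closed[OF D] subgroup.m_inv_closed[OF D] by auto
    then show "g \<otimes>\<^bsub>G\<lparr>carrier := D\<rparr>\<^esub> x \<otimes>\<^bsub>G\<lparr>carrier := D\<rparr>\<^esub> inv\<^bsub>G\<lparr>carrier := D\<rparr>\<^esub> g \<in> M"
      using m_inv_consistent[OF D] g by simp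
  qed
  moreover have "s_number s (card D div card M)"
  proof (rule s_numberI, rule ccontr)
    fix p assume p: "nat_prime p" "p dvd card D div card M" "p \<notin> s"
    have "\<not> p dvd card D div card M"
    proof (rule not_prime_dvd_index[OF fin D sM p(1)])
      fix x n assume x: "x \<in> D" "x [^] (p ^ n :: nat) = \<one>"
      have "s_number (- s) (p ^ n)" "p ^ n > 0" using s_number_prime_power[of p "- s" n] p prime_gt_0_nat by auto
      then show "x \<in> M" using x Dc by (auto simp: M_def pi_roots_def intro!: exI[of _ "p ^ n"])
    qed
    then show False using p by blast
  qed
  ultimately show "O_sigma s G D \<subseteq> pi_roots G (- s) {\<one>} \<inter> D"
    unfolding O_sigma_def M_def by blast
  show "pi_roots G (- s) {\<one>} \<inter> D \<subseteq> O_sigma s G D"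
    unfolding O_sigma_def
  proof (intro subsetI InterI)
    fix x N assume x: "x \<in> pi_roots G (- s) {\<one>} \<inter> D"
      and "N \<in> {N. N \<lhd> G\<lparr>carrier := D\<rparr> \<and> s_number s (card D div card N)}"
    then have N: "N \<lhd> G\<lparr>carrier := D\<rparr>" "s_number s (card D div card N)" by auto
    obtain m where m: "m > 0" "s_number (- s) m" "x [^] m = \<one>" using x by (auto simp: pi_roots_def)
    have sN: "subgroup N G" "N \<subseteq> D"
      using incl_subgroup[OF D normal_imp_subgroup[OF N(1)]] subgroup.subset[OF normal_imp_subgroup[OF N(1)]] by auto
    have "card N dvd card D" using card_subgroup_mono_dvd[OF fin sN(1) D sN(2)] .
    then have "card D div card N > 0" using card_subgroup_pos[OF fin D] by (metis dvd_div_eq_0_iff not_gr_zero)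
    then have "coprime m (order (G\<lparr>carrier := D\<rparr>) div card N)"
      using s_number_coprime[OF N(2) m(2) _ m(1)] by (simp add: order_def coprime_commute)
    then show "x \<in> N"
      using D.pow_one_normal_mem[OF finD N(1), of x m] x m by (simp add: nat_pow_consistent[symmetric])
  qed
qed

theorem theoremB:
  fixes G :: "('a, 'b) monoid_scheme" and \<Sigma> :: "nat set set" and D :: "'a set"
  assumes "partition_on primes_set \<Sigma>"
    and "group G" and "finite (carrier G)"
    and "D \<lhd> G" and "hall_subgroup G D"
    and "sigma_nilpotent \<Sigma> (G\<lparr>carrier := D\<rparr>)"
    and "sigma_nilpotent \<Sigma> (G Mod D)"
    and "\<forall>s\<in>sigma_of_nat \<Sigma> (card D). special_PsT \<Sigma> (G Mod (O_sigma s G D))"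
  shows "PsT_group \<Sigma> G"
proof -
  note part = assms(1) and fin = assms(3)
  interpret group G by (rule assms(2))
  interpret D: normal D G by (rule assms(4))
  interpret gD: group "G\<lparr>carrier := D\<rparr>" by (rule subgroup_imp_group[OF D.is_subgroup])
  let ?S = "sigma_of_nat \<Sigma> (card D)"
  \<comment> \<open>\<open>M s\<close> will be O^s(D), the s'-part of D, and \<open>P s\<close> is
    the s-part; \<open>W s\<close> is the preimage in G of the residual of G /
    \<open>M s\<close>.\<close>
  define M where "M s = pi_roots G (- s) {\<one>\<^bsub>G\<^esub>} \<inter> D" for s
  define P where "P s = pi_roots G s {\<one>\<^bsub>G\<^esub>} \<inter> D" for s
  define C where "C s = sigma_nilpotent_residual \<Sigma> (G Mod M s)" for s
  define W where "W s = {x \<in> carrier G. M s #>\<^bsub>G\<^esub> x \<in> C s}" for s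
  \<comment> \<open>Inserting D places R inside D and keeps the family nonempty when \<sigma>(D) is
    empty.\<close>
  define R where "R = \<Inter>(insert D (W ` ?S))"
  have S\<Sigma>: "\<And>s. s \<in> ?S \<Longrightarrow> s \<in> \<Sigma>" by (simp add: sigma_of_nat_def)
  have finD: "finite (carrier (G\<lparr>carrier := D\<rparr>))" using fin D.subset finite_subset by auto
  have "{\<one>\<^bsub>G\<^esub>} \<inter> D = {\<one>\<^bsub>G\<^esub>}" using D.one_closed by blast
  then have restr: "pi_roots (G\<lparr>carrier := D\<rparr>) s {\<one>\<^bsub>G\<lparr>carrier := D\<rparr>\<^esub>} = pi_roots G s {\<one>\<^bsub>G\<^esub>} \<inter> D" for s
    using pi_roots_restrict[OF D.is_subgroup, of s "{\<one>\<^bsub>G\<^esub>}"] by simp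
  have sM: "subgroup (M s) G" and sP: "subgroup (P s) G" if "s \<in> \<Sigma>" for s
    using gD.sigma_nilpotent_pi_roots[OF finD part assms(6) that] incl_subgroup[OF D.is_subgroup]
    unfolding restr M_def P_def by auto
  \<comment> \<open>The lifting device: a congruence modulo \<open>M s\<close> between elements of
    \<open>P s\<close> is an equality.\<close>
  have PM: "x = \<one>\<^bsub>G\<^esub>" if "x \<in> P s" "x \<in> M s" for x s
    using that pow_coprime_one[of x] s_number_coprime[of s] by (auto simp: P_def M_def pi_roots_def)
  have OM: "O_sigma s G D = M s" if "s \<in> ?S" for s
    using O_sigma_eq[OF fin D.is_subgroup] sM[OF S\<Sigma>[OF that]] unfolding M_def by blast
  have Mn: "M s \<lhd> G" if "s \<in> ?S" for s
  proof (rule normal_invI[OF sM[OF S\<Sigma>[OF that]]])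
    fix g x assume g: "g \<in> carrier G" and x: "x \<in> M s"
    then obtain m where m: "m > 0" "s_number (- s) m" "x [^]\<^bsub>G\<^esub> m = \<one>\<^bsub>G\<^esub>" by (auto simp: M_def pi_roots_def)
    have xD: "x \<in> D" using x by (simp add: M_def)
    have "(g \<otimes>\<^bsub>G\<^esub> x \<otimes>\<^bsub>G\<^esub> inv\<^bsub>G\<^esub> g) [^]\<^bsub>G\<^esub> m = \<one>\<^bsub>G\<^esub>" using conj_pow[OF g D.mem_carrier[OF xD]] m g by simp
    then show "g \<otimes>\<^bsub>G\<^esub> x \<otimes>\<^bsub>G\<^esub> inv\<^bsub>G\<^esub> g \<in> M s"
      unfolding M_def pi_roots_def using m D.inv_op_closed2[OF g xD] D.mem_carrier by auto
  qed
  have hom: "group_hom G (G Mod M s) ((#>\<^bsub>G\<^esub>) (M s))" if "s \<in> ?S" for s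
    using normal.rcos_group_hom[OF Mn[OF that]] .
  have ph: "power_hall (G Mod M s) \<Sigma> (C s)" if "s \<in> ?S" for s
    unfolding C_def
    using group.special_PsT_power_hall[OF normal.factorgroup_is_group[OF Mn[OF that]] FactGroup_finite[OF fin] part]
      assms(8) OM[OF that] that by auto
  have sW: "subgroup (W s) G" if "s \<in> ?S" for s
    unfolding W_def using group_hom.subgroup_preimage[OF hom[OF that] power_hall.R_sub[OF ph[OF that]]] .
  have sR: "subgroup R G"
    unfolding R_def by (rule subgroups_Inter) (use D.is_subgroup sW in auto)
  have RD: "R \<subseteq> D" and RW: "\<And>s x. x \<in> R \<Longrightarrow> s \<in> ?S \<Longrightarrow> M s #>\<^bsub>G\<^esub> x \<in> C s"
    by (auto simp: R_def W_def)
  have RI: "x \<in> R" if "x \<in> D" "\<And>s. s \<in> ?S \<Longrightarrow> M s #>\<^bsub>G\<^esub> x \<in> C s" for x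
    using that D.mem_carrier by (auto simp: R_def W_def)
  have Rc: "\<And>x. x \<in> R \<Longrightarrow> x \<in> carrier G" using RD D.mem_carrier by blast
  have mem_one: "M s #>\<^bsub>G\<^esub> x = \<one>\<^bsub>G Mod M s\<^esub> \<longleftrightarrow> x \<in> M s" if "s \<in> ?S" "x \<in> carrier G" for s x
    using normal.rcos_eq_self_iff[OF Mn[OF that(1)] that(2)] by simp
  have prime_in_S: "\<exists>s\<in>?S. p \<in> s" if p: "nat_prime p" "p dvd card D" for p
  proof -
    obtain s where "s \<in> \<Sigma>" "p \<in> s" using part p by (auto simp: partition_on_def primes_set_def)
    moreover have "p \<in> prime_factors (card D)"
      using p card_subgroup_pos[OF fin D.is_subgroup] by (simp add: in_prime_factors_iff)
    ultimately show ?thesis by (auto simp: sigma_of_nat_def)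
  qed
  have p_mem: "x \<in> P s" if "x \<in> D" "nat_prime p" "p \<in> s" "x [^]\<^bsub>G\<^esub> (p ^ n :: nat) = \<one>\<^bsub>G\<^esub>" for x s p n
    using that s_number_prime_power[of p s n] prime_gt_0_nat[of p] D.mem_carrier
    by (auto simp: P_def pi_roots_def intro!: exI[of _ "p ^ n"])
  have hom_pow: "(M s #>\<^bsub>G\<^esub> x) [^]\<^bsub>G Mod M s\<^esub> n = M s #>\<^bsub>G\<^esub> (x [^]\<^bsub>G\<^esub> n)" if "s \<in> ?S" "x \<in> carrier G" for s x and n :: nat
    using normal.FactGroup_pow[OF Mn[OF that(1)] that(2)] .
  have hom_carrier: "M s #>\<^bsub>G\<^esub> x \<in> carrier (G Mod M s)" if "x \<in> carrier G" for s x
    using that by (auto simp: carrier_FactGroup)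
  have hom_pow_one: "(M s #>\<^bsub>G\<^esub> x) [^]\<^bsub>G Mod M s\<^esub> n = \<one>\<^bsub>G Mod M s\<^esub>"
    if "s \<in> ?S" "x \<in> carrier G" "x [^]\<^bsub>G\<^esub> n = \<one>\<^bsub>G\<^esub>" for s x and n :: nat
    using hom_pow[OF that(1,2), of n] that(3) group_hom.hom_one[OF hom[OF that(1)]] by simp
  have Rn: "R \<lhd> G"
  proof (rule normal_invI[OF sR], rule RI)
    fix g x assume g: "g \<in> carrier G" and x: "x \<in> R"
    show "g \<otimes>\<^bsub>G\<^esub> x \<otimes>\<^bsub>G\<^esub> inv\<^bsub>G\<^esub> g \<in> D" using D.inv_op_closed2[OF g] x RD by blast
    fix s assume s: "s \<in> ?S"
    interpret h: group_hom G "G Mod M s" "(#>\<^bsub>G\<^esub>) (M s)" by (rule hom[OF s])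
    have "M s #>\<^bsub>G\<^esub> (g \<otimes>\<^bsub>G\<^esub> x \<otimes>\<^bsub>G\<^esub> inv\<^bsub>G\<^esub> g) =
        (M s #>\<^bsub>G\<^esub> g) \<otimes>\<^bsub>G Mod M s\<^esub> (M s #>\<^bsub>G\<^esub> x) \<otimes>\<^bsub>G Mod M s\<^esub> inv\<^bsub>G Mod M s\<^esub> (M s #>\<^bsub>G\<^esub> g)"
      using g Rc[OF x] by (simp only: h.hom_mult h.hom_inv m_closed inv_closed)
    then show "M s #>\<^bsub>G\<^esub> (g \<otimes>\<^bsub>G\<^esub> x \<otimes>\<^bsub>G\<^esub> inv\<^bsub>G\<^esub> g) \<in> C s"
      using normal.inv_op_closed2[OF power_hall.R_normal[OF ph[OF s]] hom_carrier[OF g] RW[OF x s]] by simp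
  qed
  have R_hall: "x \<in> R" if p: "nat_prime p" "p dvd card R" and x: "x \<in> carrier G" "x [^]\<^bsub>G\<^esub> (p ^ n :: nat) = \<one>\<^bsub>G\<^esub>" for p x n
  proof (rule RI)
    have pD: "p dvd card D" using p card_subgroup_mono_dvd[OF fin sR D.is_subgroup RD] dvd_trans by blast
    have "\<not> p dvd order G div card D"
      using assms(5) pD p(1) by (metis coprime_common_divisor_nat hall_subgroup_def not_prime_1)
    then show xD: "x \<in> D"
      using pow_one_normal_mem[OF fin assms(4) x] coprime_prime_power[OF p(1)] by blast
    fix t assume t: "t \<in> ?S"
    interpret pt: power_hall "G Mod M t" \<Sigma> "C t" by (rule ph[OF t])
    show "M t #>\<^bsub>G\<^esub> x \<in> C t"
    proof (cases "p \<in> t")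
      case True
      \<comment> \<open>An element of order p in R survives in G / \<open>M t\<close>, so p divides
        |\<open>C t\<close>| and the Hall property of \<open>C t\<close> applies to the image of
        x.\<close>
      obtain y where y: "y \<in> R" "y \<noteq> \<one>\<^bsub>G\<^esub>" "y [^]\<^bsub>G\<^esub> p = \<one>\<^bsub>G\<^esub>" using cauchy[OF fin sR p] .
      have "y \<in> P t" using p_mem[of y p t 1] y RD p(1) True by auto
      then have "y \<notin> M t" using PM y by blast
      then have "M t #>\<^bsub>G\<^esub> y \<noteq> \<one>\<^bsub>G Mod M t\<^esub>" using mem_one[OF t Rc[OF y(1)]] by blast
      then have "p dvd card (C t)"
        using pt.prime_dvd_card_subgroup[OF pt.fin pt.R_sub RW[OF y(1) t] _ p(1), of 1]
          hom_pow_one[OF t Rc[OF y(1)] y(3)] by simp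
      then show ?thesis using pt.R_hall[OF p(1) _ hom_carrier[OF x(1)] hom_pow_one[OF t x]] by blast
    next
      case False
      then have "x \<in> M t"
        using xD x s_number_prime_power[of p "- t" n] p prime_gt_0_nat[of p]
        by (auto simp: M_def pi_roots_def intro!: exI[of _ "p ^ n"])
      then have "M t #>\<^bsub>G\<^esub> x = \<one>\<^bsub>G Mod M t\<^esub>" using mem_one[OF t x(1)] by blast
      then show ?thesis using subgroup.one_closed[OF pt.R_sub] by simp
    qed
  qed
  have R_power: "\<exists>n::nat. inv\<^bsub>G\<^esub> g \<otimes>\<^bsub>G\<^esub> x \<otimes>\<^bsub>G\<^esub> g = x [^]\<^bsub>G\<^esub> n" if x: "x \<in> R" and g: "g \<in> carrier G" for x g
  proof -
    have xc: "x \<in> carrier G" using Rc[OF x] .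
    \<comment> \<open>The conjugate of each component y is recorded as a power of x rather than of
      y, so that exponents add when components are multiplied.\<close>
    let ?U = "{y \<in> carrier G. \<exists>n::nat. inv\<^bsub>G\<^esub> g \<otimes>\<^bsub>G\<^esub> y \<otimes>\<^bsub>G\<^esub> g = x [^]\<^bsub>G\<^esub> n}"
    have "x \<in> ?U"
    proof (rule primary_induct[OF fin xc])
      fix y z assume "y \<in> ?U" "z \<in> ?U"
      then obtain i j where ij: "inv\<^bsub>G\<^esub> g \<otimes>\<^bsub>G\<^esub> y \<otimes>\<^bsub>G\<^esub> g = x [^]\<^bsub>G\<^esub> (i::nat)" "inv\<^bsub>G\<^esub> g \<otimes>\<^bsub>G\<^esub> z \<otimes>\<^bsub>G\<^esub> g = x [^]\<^bsub>G\<^esub> (j::nat)"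
        and c: "y \<in> carrier G" "z \<in> carrier G" by blast
      have "x [^]\<^bsub>G\<^esub> (i + j) = (inv\<^bsub>G\<^esub> g \<otimes>\<^bsub>G\<^esub> y \<otimes>\<^bsub>G\<^esub> g) \<otimes>\<^bsub>G\<^esub> (inv\<^bsub>G\<^esub> g \<otimes>\<^bsub>G\<^esub> z \<otimes>\<^bsub>G\<^esub> g)"
        unfolding ij using xc by (simp add: nat_pow_mult)
      also have "\<dots> = inv\<^bsub>G\<^esub> g \<otimes>\<^bsub>G\<^esub> y \<otimes>\<^bsub>G\<^esub> (g \<otimes>\<^bsub>G\<^esub> inv\<^bsub>G\<^esub> g) \<otimes>\<^bsub>G\<^esub> z \<otimes>\<^bsub>G\<^esub> g"
        using c g by (simp only: m_assoc m_closed inv_closed)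
      finally have "inv\<^bsub>G\<^esub> g \<otimes>\<^bsub>G\<^esub> (y \<otimes>\<^bsub>G\<^esub> z) \<otimes>\<^bsub>G\<^esub> g = x [^]\<^bsub>G\<^esub> (i + j)"
        using c g by (simp add: m_assoc)
      then show "y \<otimes>\<^bsub>G\<^esub> z \<in> ?U" using c by blast
    next
      fix i p n assume p: "nat_prime p" and ip: "(x [^]\<^bsub>G\<^esub> (i::nat)) [^]\<^bsub>G\<^esub> (p ^ n :: nat) = \<one>\<^bsub>G\<^esub>"
      define y where "y = x [^]\<^bsub>G\<^esub> i"
      have yR: "y \<in> R" unfolding y_def by (rule subgroup_nat_pow_closed[OF sR x])
      have yc: "y \<in> carrier G" using Rc[OF yR] .
      have yp: "y [^]\<^bsub>G\<^esub> (p ^ n) = \<one>\<^bsub>G\<^esub>" using ip by (simp add: y_def)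
      have "\<exists>j::nat. inv\<^bsub>G\<^esub> g \<otimes>\<^bsub>G\<^esub> y \<otimes>\<^bsub>G\<^esub> g = y [^]\<^bsub>G\<^esub> j"
      proof (cases "y = \<one>\<^bsub>G\<^esub>")
        case True
        then show ?thesis using g by (intro exI[of _ 0]) simp
      next
        case False
        have "p dvd card D" using prime_dvd_card_subgroup[OF fin D.is_subgroup _ False p yp] yR RD by blast
        then obtain s where s: "s \<in> ?S" "p \<in> s" using prime_in_S[OF p] by blast
        interpret ps: power_hall "G Mod M s" \<Sigma> "C s" by (rule ph[OF s(1)])
        interpret h: group_hom G "G Mod M s" "(#>\<^bsub>G\<^esub>) (M s)" by (rule hom[OF s(1)])
        define w where "w = inv\<^bsub>G\<^esub> g \<otimes>\<^bsub>G\<^esub> y \<otimes>\<^bsub>G\<^esub> g"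
        have wD: "w \<in> D" unfolding w_def using D.inv_op_closed1[OF g] yR RD by blast
        have wc: "w \<in> carrier G" using D.mem_carrier[OF wD] .
        have wp: "w [^]\<^bsub>G\<^esub> (p ^ n) = \<one>\<^bsub>G\<^esub>"
          unfolding w_def using conj_pow[of "inv\<^bsub>G\<^esub> g" y "p ^ n"] g yc yp by simp
        have wP: "w \<in> P s" using p_mem[OF wD p s(2) wp] .
        have yP: "y \<in> P s" using p_mem[OF _ p s(2) yp] yR RD by blast
        obtain j where "inv\<^bsub>G Mod M s\<^esub> (M s #>\<^bsub>G\<^esub> g) \<otimes>\<^bsub>G Mod M s\<^esub> (M s #>\<^bsub>G\<^esub> y) \<otimes>\<^bsub>G Mod M s\<^esub> (M s #>\<^bsub>G\<^esub> g)
            = (M s #>\<^bsub>G\<^esub> y) [^]\<^bsub>G Mod M s\<^esub> (j::nat)"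
          using ps.R_power[OF RW[OF yR s(1)] hom_carrier[OF g]] by blast
        then have "M s #>\<^bsub>G\<^esub> w = M s #>\<^bsub>G\<^esub> (y [^]\<^bsub>G\<^esub> j)"
          unfolding w_def using g yc by (simp only: h.hom_mult h.hom_inv h.hom_nat_pow m_closed inv_closed)
        then have "M s #>\<^bsub>G\<^esub> (w \<otimes>\<^bsub>G\<^esub> inv\<^bsub>G\<^esub> (y [^]\<^bsub>G\<^esub> j)) = \<one>\<^bsub>G Mod M s\<^esub>"
          using wc yc by (metis ps.r_inv h.hom_closed h.hom_inv h.hom_mult inv_closed nat_pow_closed)
        then have "w \<otimes>\<^bsub>G\<^esub> inv\<^bsub>G\<^esub> (y [^]\<^bsub>G\<^esub> j) \<in> M s"
          using mem_one[OF s(1)] wc yc by (metis inv_closed m_closed nat_pow_closed)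
        moreover have "w \<otimes>\<^bsub>G\<^esub> inv\<^bsub>G\<^esub> (y [^]\<^bsub>G\<^esub> j) \<in> P s"
          using sP[OF S\<Sigma>[OF s(1)]] wP yP subgroup_nat_pow_closed
          by (metis subgroup.m_closed subgroup.m_inv_closed)
        ultimately have "w \<otimes>\<^bsub>G\<^esub> inv\<^bsub>G\<^esub> (y [^]\<^bsub>G\<^esub> j) = \<one>\<^bsub>G\<^esub>" using PM by blast
        then have "w = y [^]\<^bsub>G\<^esub> j" using wc yc by (metis inv_closed inv_equality inv_inv nat_pow_closed)
        then show ?thesis unfolding w_def by blast
      qed
      then obtain j where "inv\<^bsub>G\<^esub> g \<otimes>\<^bsub>G\<^esub> y \<otimes>\<^bsub>G\<^esub> g = x [^]\<^bsub>G\<^esub> (i * j :: nat)"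
        unfolding y_def using xc by (auto simp: nat_pow_pow)
      then show "x [^]\<^bsub>G\<^esub> i \<in> ?U" using yc unfolding y_def by blast
    qed
    then show ?thesis by blast
  qed
  have roots: "subgroup (pi_roots G t R) G" if t: "t \<in> \<Sigma>" for t
    unfolding R_def
  proof (rule pi_roots_Inter_subgroup[OF fin])
    fix N assume "N \<in> insert D (W ` ?S)"
    then consider "N = D" | s where "s \<in> ?S" "N = W s" by blast
    then show "subgroup N G" "subgroup (pi_roots G t N) G"
    \<comment> \<open>For D the claim comes from the \<sigma>-nilpotence of G / D, for
      \<open>W s\<close> by pulling back from G / \<open>M s\<close>.\<close>
    proof (atomize (full), cases)
      case 1
      then show "subgroup N G \<and> subgroup (pi_roots G t N) G"
        using D.is_subgroup sigma_nilpotent_Mod_pi_roots[OF fin part assms(4,7) t] by simp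
    next
      case (2 s)
      interpret h: group_hom G "G Mod M s" "(#>\<^bsub>G\<^esub>) (M s)" by (rule hom[OF 2(1)])
      have "subgroup (pi_roots G t (W s)) G"
        unfolding W_def h.pi_roots_preimage
        by (rule h.subgroup_preimage[OF power_hall.roots[OF ph[OF 2(1)] t]])
      then show "subgroup N G \<and> subgroup (pi_roots G t N) G" using sW 2 by simp
    qed
  qed
  have comm: "k \<otimes>\<^bsub>G\<^esub> r = r \<otimes>\<^bsub>G\<^esub> k"
    if t: "t \<in> \<Sigma>" and pq: "nat_prime p" "nat_prime q" "p \<in> t" "q \<in> t" "p \<noteq> q"
      and k: "k \<in> carrier G" "k [^]\<^bsub>G\<^esub> (p ^ m :: nat) = \<one>\<^bsub>G\<^esub>" and r: "r \<in> R" "r [^]\<^bsub>G\<^esub> (q ^ n :: nat) = \<one>\<^bsub>G\<^esub>" for t p q k m r n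
  proof (cases "r = \<one>\<^bsub>G\<^esub>")
    case True
    then show ?thesis using k by simp
  next
    case False
    have rc: "r \<in> carrier G" using Rc[OF r(1)] .
    have "q dvd card D" using prime_dvd_card_subgroup[OF fin D.is_subgroup _ False pq(2) r(2)] r(1) RD by blast
    then obtain s where s: "s \<in> ?S" "q \<in> s" using prime_in_S[OF pq(2)] by blast
    have "s = t" using s(2) pq(4) t S\<Sigma>[OF s(1)] partition_onD2[OF part] unfolding disjoint_def by blast
    interpret ps: power_hall "G Mod M s" \<Sigma> "C s" by (rule ph[OF s(1)])
    interpret h: group_hom G "G Mod M s" "(#>\<^bsub>G\<^esub>) (M s)" by (rule hom[OF s(1)])
    \<comment> \<open>The commutator is trivial in G / \<open>M s\<close>, hence lies in
      \<open>M s\<close>; it is also a power of r times the inverse of r, hence lies in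
      \<open>P s\<close>.\<close>
    let ?c = "k \<otimes>\<^bsub>G\<^esub> r \<otimes>\<^bsub>G\<^esub> inv\<^bsub>G\<^esub> k \<otimes>\<^bsub>G\<^esub> inv\<^bsub>G\<^esub> r"
    have cc: "?c \<in> carrier G" using k rc by simp
    have kr: "(M s #>\<^bsub>G\<^esub> k) \<otimes>\<^bsub>G Mod M s\<^esub> (M s #>\<^bsub>G\<^esub> r) = (M s #>\<^bsub>G\<^esub> r) \<otimes>\<^bsub>G Mod M s\<^esub> (M s #>\<^bsub>G\<^esub> k)"
      using ps.primary_commute[OF t pq hom_carrier[OF k(1)] hom_pow_one[OF s(1) k] RW[OF r(1) s(1)] hom_pow_one[OF s(1) rc r(2)]] .
    have "M s #>\<^bsub>G\<^esub> ?c = (M s #>\<^bsub>G\<^esub> k) \<otimes>\<^bsub>G Mod M s\<^esub> (M s #>\<^bsub>G\<^esub> r) \<otimes>\<^bsub>G Mod M s\<^esub>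
        inv\<^bsub>G Mod M s\<^esub> (M s #>\<^bsub>G\<^esub> k) \<otimes>\<^bsub>G Mod M s\<^esub> inv\<^bsub>G Mod M s\<^esub> (M s #>\<^bsub>G\<^esub> r)"
      using k rc by (simp only: h.hom_mult h.hom_inv m_closed inv_closed)
    also have "\<dots> = \<one>\<^bsub>G Mod M s\<^esub>"
      unfolding kr using hom_carrier[OF k(1), of s] hom_carrier[OF rc, of s]
      by (metis ps.inv_closed ps.m_assoc ps.r_inv ps.r_one)
    finally have cM: "?c \<in> M s" using mem_one[OF s(1) cc] by blast
    have rP: "r \<in> P s" using p_mem[OF _ pq(2) s(2) r(2)] r(1) RD by blast
    obtain j where "inv\<^bsub>G\<^esub> (inv\<^bsub>G\<^esub> k) \<otimes>\<^bsub>G\<^esub> r \<otimes>\<^bsub>G\<^esub> inv\<^bsub>G\<^esub> k = r [^]\<^bsub>G\<^esub> (j::nat)"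
      using R_power[OF r(1), of "inv\<^bsub>G\<^esub> k"] k by auto
    then have "?c = r [^]\<^bsub>G\<^esub> j \<otimes>\<^bsub>G\<^esub> inv\<^bsub>G\<^esub> r" using k by simp
    then have "?c \<in> P s"
      using sP[OF S\<Sigma>[OF s(1)]] rP subgroup_nat_pow_closed
      by (metis subgroup.m_closed subgroup.m_inv_closed)
    then have "?c = \<one>\<^bsub>G\<^esub>" using PM cM by blast
    then show ?thesis using commute_of_commutator_one[OF k(1) rc] by blast
  qed
  have "power_hall G \<Sigma> R"
    by (intro power_hall.intro power_hall_axioms.intro group_axioms part fin Rn)
      (fact R_hall R_power roots comm)+
  then show ?thesis by (rule power_hall.PsT_group)
qed

end
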